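(* Let $n\ge1$ and let $\mathbf{T}_n$ be a uniformly random binary tree with $n$ vertices. Fix integers $0<k_1<k_2$ (or $k_1<k_2<0$), and $(\delta_1,m_1,s_1),(\delta_2,m_2,s_2)\in\mathbb{Z}\times\mathbb{Z}_{>0}\times\mathbb{Z}$. Then the law of $(Z^\star_j,\ k_1\le j\le k_2)$ conditioned on $Z^\star_{k_i}=(\delta_i,m_i,s_i)$ for $i=1,2$ is equal to the law of $(Z_j(\mathbf{T}_n),\ k_1\le j\le k_2)$ conditioned on $Z_{k_i}(\mathbf{T}_n)=(\delta_i,m_i,s_i)$ for $i=1,2$ (whenever both conditioning events have positive probability).
   Context: A binary tree is a rooted plane tree in which each vertex has a (possibly empty) left subtree and a (possibly empty) right subtree. The abscissa of a vertex $v$ is the number of right steps minus the number of left steps on the path from the root to $v$. For a binary tree $T$ and $i\in\mathbb{Z}$, $M_i(T)$ is the number of vertices of $T$ of abscissa $i$, $\Delta_i(T)=M_i(T)-M_{i-1}(T)$, $S_i(T)=\sum_{j\le i}M_j(T)$ and $Z_i(T)=(\Delta_i(T),M_i(T),S_i(T))$. The companion process $Z^\star=(Z^\star_k)=((\Delta^\star_k,M^\star_k,S^\star_k))$ is the time-homogeneous Markov chain with values in $\mathbb{Z}^3$ defined as follows: conditionally on $(\Delta^\star_i,M^\star_i,S^\star_i)=(\delta,m,s)$ (and the past), $$\Delta^\star_{i+1}=\delta+\sum_{k=1}^{|m|}(g^{(k)}-2),\qquad M^\star_{i+1}=m+\Delta^\star_{i+1},\qquad S^\star_{i+1}=s+M^\star_{i+1},$$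 where $g^{(1)},g^{(2)},\dots$ are i.i.d. (fresh at each step) geometric variables with $\mathbb{P}(g^{(k)}=j)=2^{-j}$, $j\ge1$. Moreover, if $M^\star_k\le0$, the process is killed at time $k$, meaning $Z^\star_{k+t}=Z^\star_k$ for all $t\ge0$. The starting time of $Z^\star$ is any integer at most $k_1$ and its starting distribution is arbitrary; one may for instance start it at time $k_1$ from $(\delta_1,m_1,s_1)$. *)

theory Defs
  imports "HOL-Probability.Probability" "HOL-Library.Tree"
begin

text \<open>
  Binary trees are unlabelled trees, of type \<^typ>\<open>unit tree\<close>; the constructor \<^const>\<open>Leaf\<close> is the
  empty subtree, so the vertices are the \<^const>\<open>Node\<close>s and their number is \<^const>\<open>size\<close>.
  A vertex is represented by the path leading to it from the root.
\<close>

datatype dir = L | R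

primrec vertices :: "'a tree \<Rightarrow> dir list set" where
  "vertices Leaf = {}"
| "vertices (Node l x r) = insert [] (Cons L ` vertices l \<union> Cons R ` vertices r)"

definition abscissa :: "dir list \<Rightarrow> int" where
  "abscissa v = int (count_list v R) - int (count_list v L)"

definition tree_M :: "'a tree \<Rightarrow> int \<Rightarrow> int" where
  "tree_M T i = int (card {v \<in> vertices T. abscissa v = i})"

definition tree_Delta :: "'a tree \<Rightarrow> int \<Rightarrow> int" where
  "tree_Delta T i = tree_M T i - tree_M T (i - 1)"

text \<open>
  The sum over all \<open>j \<le> i\<close> has finitely many nonzero terms (lemma \<open>finite_tree_M_support\<close> below);
  it is restricted to these because \<^const>\<open>sum\<close> is 0 on infinite index sets.
\<close>

definition tree_S :: "'a tree \<Rightarrow> int \<Rightarrow> int" where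
  "tree_S T i = (\<Sum>j | j \<le> i \<and> tree_M T j \<noteq> 0. tree_M T j)"

definition tree_Z :: "'a tree \<Rightarrow> int \<Rightarrow> int \<times> int \<times> int" where
  "tree_Z T i = (tree_Delta T i, tree_M T i, tree_S T i)"

definition random_tree :: "nat \<Rightarrow> unit tree pmf" where
  "random_tree n = pmf_of_set {T. size T = n}"

text \<open>
  The library's \<^const>\<open>geometric_pmf\<close> is supported on \<open>{0, 1, \<dots>}\<close>, hence the shift.
\<close>

definition geom :: "nat pmf" where
  "geom = map_pmf Suc (geometric_pmf (1/2))"

text \<open>
  The transition kernel. The variables \<open>g k\<close> with \<open>1 \<le> k \<le> \<bar>m\<bar>\<close> are independent copies of
  \<^const>\<open>geom\<close>; the second argument of \<^const>\<open>Pi_pmf\<close> is an irrelevant default value.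
  States with \<open>m \<le> 0\<close> are absorbing, which encodes the killing.
\<close>

definition companion_step :: "int \<times> int \<times> int \<Rightarrow> (int \<times> int \<times> int) pmf" where
  "companion_step = (\<lambda>(\<delta>, m, s).
     if m \<le> 0 then return_pmf (\<delta>, m, s)
     else map_pmf (\<lambda>g. let \<delta>' = \<delta> + (\<Sum>k = 1..nat \<bar>m\<bar>. (int (g k) - 2));
                          m' = m + \<delta>';
                          s' = s + m'
                      in (\<delta>', m', s'))
            (Pi_pmf {1..nat \<bar>m\<bar>} 0 (\<lambda>_. geom)))"

text \<open>
  \<open>Z\<close> is a Markov chain on the probability space \<open>P\<close>, started at time \<open>k\<^sub>0\<close>, with kernel
  \<^const>\<open>companion_step\<close>. The law of \<open>Z k\<^sub>0\<close> is unconstrained. As the state space is countable,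
  elementary conditioning on the whole past suffices.
\<close>

definition companion_process ::
  "'w measure \<Rightarrow> int \<Rightarrow> (int \<Rightarrow> 'w \<Rightarrow> int \<times> int \<times> int) \<Rightarrow> bool" where
  "companion_process P k\<^sub>0 Z \<longleftrightarrow>
     prob_space P \<and>
     (\<forall>k\<ge>k\<^sub>0. Z k \<in> P \<rightarrow>\<^sub>M count_space UNIV) \<and>
     (\<forall>k\<ge>k\<^sub>0. \<forall>z z'.
        \<P>(\<omega> in P. \<forall>j\<in>{k\<^sub>0..k}. Z j \<omega> = z j) > 0 \<longrightarrow>
        \<P>(\<omega> in P. Z (k + 1) \<omega> = z' \<bar> \<forall>j\<in>{k\<^sub>0..k}. Z j \<omega> = z j) = pmf (companion_step (z k)) z')"

text \<open>
  The law of \<open>(Z j)\<close>, \<open>k\<^sub>1 \<le> j \<le> k\<^sub>2\<close>, conditioned on the event \<open>Z k\<^sub>1 = z\<^sub>1\<close> and \<open>Z k\<^sub>2 = z\<^sub>2\<close>,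
  as a measure on the space of paths indexed by \<open>{k\<^sub>1..k\<^sub>2}\<close>. Meaningful when the event has
  positive probability.
\<close>

definition bridge_law ::
  "'w measure \<Rightarrow> (int \<Rightarrow> 'w \<Rightarrow> 'z) \<Rightarrow> int \<Rightarrow> int \<Rightarrow> 'z \<Rightarrow> 'z \<Rightarrow> (int \<Rightarrow> 'z) measure" where
  "bridge_law P Z k\<^sub>1 k\<^sub>2 z\<^sub>1 z\<^sub>2 =
     distr (uniform_measure P {\<omega> \<in> space P. Z k\<^sub>1 \<omega> = z\<^sub>1 \<and> Z k\<^sub>2 \<omega> = z\<^sub>2})
       (\<Pi>\<^sub>M j\<in>{k\<^sub>1..k\<^sub>2}. count_space UNIV) (\<lambda>\<omega>. \<lambda>j\<in>{k\<^sub>1..k\<^sub>2}. Z j \<omega>)"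


lemma finite_vertices: "finite (vertices T)"
  by (induction T) auto

lemma card_vertices: "card (vertices T) = size T"
proof (induction T)
  case (Node l x r)
  have "card (Cons L ` vertices l \<union> Cons R ` vertices r) = size l + size r"
    using Node by (subst card_Un_disjoint) (auto simp: finite_vertices card_image)
  then show ?case
    by (auto simp: finite_vertices card_insert_if)
qed simp

lemma finite_tree_M_support: "finite {j. tree_M T j \<noteq> 0}"
proof (rule finite_subset)
  show "{j. tree_M T j \<noteq> 0} \<subseteq> abscissa ` vertices T"
  proof
    fix j assume "j \<in> {j. tree_M T j \<noteq> 0}"
    then have "{v \<in> vertices T. abscissa v = j} \<noteq> {}"
      unfolding tree_M_def by (metis (mono_tags, lifting) card.empty mem_Collect_eq of_nat_0)
    then show "j \<in> abscissa ` vertices T" by auto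
  qed
qed (simp add: finite_vertices)

lemma finite_trees: "finite {T :: unit tree. size T \<le> n}"
proof (induction n)
  case (Suc n)
  let ?A = "{T :: unit tree. size T \<le> n}"
  have "{T :: unit tree. size T \<le> Suc n} \<subseteq> insert Leaf ((\<lambda>(l, r). Node l () r) ` (?A \<times> ?A))"
  proof
    fix T :: "unit tree" assume "T \<in> {T. size T \<le> Suc n}"
    then show "T \<in> insert Leaf ((\<lambda>(l, r). Node l () r) ` (?A \<times> ?A))"
      by (cases T) auto
  qed
  then show ?case using Suc by (meson finite_SigmaI finite_imageI finite_insert finite_subset)
qed simp

lemma ex_tree: "\<exists>T :: unit tree. size T = n"
proof (induction n)
  case 0
  show ?case by (rule exI[of _ Leaf]) simp
next
  case (Suc n)
  then obtain T :: "unit tree" where "size T = n" by blast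
  then show ?case by (intro exI[of _ "Node Leaf () T"]) simp
qed

lemma set_random_tree: "set_pmf (random_tree n) = {T. size T = n}"
proof -
  have "finite {T :: unit tree. size T = n}"
    by (rule finite_subset[OF _ finite_trees[of n]]) auto
  then show ?thesis using ex_tree[of n] by (simp add: random_tree_def set_pmf_of_set)
qed

lemma pmf_geom: "j \<ge> 1 \<Longrightarrow> pmf geom j = 1 / 2 ^ j"
proof -
  assume "j \<ge> 1"
  then obtain i where j: "j = Suc i" by (cases j) auto
  show ?thesis unfolding geom_def j
    by (subst pmf_map_inj') (auto simp: power_one_over)
qed

end

theory Submission
  imports Defs
begin

text \<open>
  Both processes are discrete, so it suffices that the probabilities of their paths
  on \<open>{k\<^sub>1..k\<^sub>2}\<close> with the prescribed end points are proportional (\<open>bridge_law_eqI\<close>). Write \<open>M j\<close> for the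
  number of vertices at abscissa \<open>j\<close>, given by the path for \<open>j\<close> in \<open>{k\<^sub>1..k\<^sub>2}\<close> and by \<open>M k\<^sub>1 - \<Delta> k\<^sub>1\<close> for
  \<open>j = k\<^sub>1 - 1\<close>. Both probabilities are a constant depending only on the end points, times the product of
  \<open>(M (j - 1) + M (j + 1) - 1) choose (M j - 1)\<close> over \<open>j\<close> from \<open>k\<^sub>1\<close> to \<open>k\<^sub>2 - 1\<close>.

  For the chain this is the negative binomial law: given \<open>M (j - 1)\<close> and \<open>M j\<close>, the next value is
  \<open>M (j + 1)\<close> if and only if \<open>M j\<close> geometric variables sum to \<open>M (j - 1) + M (j + 1)\<close>
  (\<open>pmf_companion_step\<close>, \<open>companion_path_weight\<close>).

  For trees it is a factorization of the number of binary trees with a given vertical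
  profile (\<open>fcount_root_profile\<close>). Consider forests of possibly empty trees with \<open>a\<close> roots at
  abscissa \<open>i\<close> and \<open>c\<close> vertices at \<open>i\<close>. Cutting along the vertices at \<open>i\<close> and an argument of cycle-lemma
  type express their number by the number of forests with \<open>c\<close> roots at each of \<open>i - 1\<close> and \<open>i + 1\<close>,
  with the factor \<open>a / c\<close> times a binomial coefficient (\<open>fcount_replicate\<close>). The two sides of
  \<open>i\<close> are independent, so this can be iterated, starting from the root and moving away from it on
  one side (\<open>fcount_one_sided\<close>). Each abscissa passed contributes its
  binomial coefficient and a quotient of consecutive numbers of vertices, and these quotients telescope.
  The rest of the tree contributes a factor that does not involve the numbers of vertices strictly
  between \<open>k\<^sub>1\<close> and \<open>k\<^sub>2 - 1\<close>; as the end points also fix the numbers of vertices at abscissae up to \<open>k\<^sub>1\<close>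
  and up to \<open>k\<^sub>2\<close>, summing over the rest of a tree with \<open>n\<close> vertices gives a constant
  (\<open>card_tree_paths\<close>).
\<close>

section \<open>Counting forests by their abscissae\<close>

text \<open>
  The multiset of the abscissae of all vertices of a tree whose root is placed at abscissa \<open>i\<close>.
\<close>
primrec abscissae :: "int \<Rightarrow> 'a tree \<Rightarrow> int multiset" where
  "abscissae i Leaf = {#}"
| "abscissae i (Node l x r) = add_mset i (abscissae (i - 1) l + abscissae (i + 1) r)"

lemma size_abscissae [simp]: "size (abscissae i T) = size T"
  by (induction T arbitrary: i) auto

text \<open>
  The same for a forest, given as a list of possibly empty trees together with the list of the
  abscissae at which their roots are placed.
\<close>
definition forest_abscissae :: "int list \<Rightarrow> unit tree list \<Rightarrow> int multiset" where
  "forest_abscissae rs ts = sum_list (map2 abscissae rs ts)"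

text \<open>
  The forests with root abscissae \<open>rs\<close> and vertex abscissae \<open>\<mu>\<close>, and their number. An entry of \<open>rs\<close>
  is only a slot in which a tree may be planted: the trees are allowed to be empty.
\<close>
definition forests :: "int list \<Rightarrow> int multiset \<Rightarrow> unit tree list set" where
  "forests rs \<mu> = {ts. length ts = length rs \<and> forest_abscissae rs ts = \<mu>}"

definition fcount :: "int list \<Rightarrow> int multiset \<Rightarrow> nat" where
  "fcount rs \<mu> = card (forests rs \<mu>)"

lemma forest_abscissae_simps [simp]:
  "forest_abscissae [] ts = {#}"
  "forest_abscissae (r # rs) (t # ts) = abscissae r t + forest_abscissae rs ts"
  by (simp_all add: forest_abscissae_def)

lemma forest_abscissae_append:
  "length ts = length rs \<Longrightarrow>
   forest_abscissae (rs @ rs') (ts @ ts') = forest_abscissae rs ts + forest_abscissae rs' ts'"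
  by (simp add: forest_abscissae_def)

lemma size_forest_abscissae:
  "length ts = length rs \<Longrightarrow> size (forest_abscissae rs ts) = sum_list (map size ts)"
  by (induction ts rs rule: list_induct2) auto

lemma finite_forests [simp]: "finite (forests rs \<mu>)"
proof (rule finite_subset)
  show "forests rs \<mu> \<subseteq> {ts. set ts \<subseteq> {T. size T \<le> size \<mu>} \<and> length ts = length rs}"
    by (auto simp: forests_def size_forest_abscissae intro!: member_le_sum_list)
qed (intro finite_lists_length_eq finite_trees)

lemma finite_submsets [simp]: "finite {\<nu>. \<nu> \<subseteq># \<mu>}"
proof (induction \<mu>)
  case (add x \<mu>)
  have "{\<nu>. \<nu> \<subseteq># add_mset x \<mu>} \<subseteq> {\<nu>. \<nu> \<subseteq># \<mu>} \<union> add_mset x ` {\<nu>. \<nu> \<subseteq># \<mu>}"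
  proof
    fix \<nu> assume "\<nu> \<in> {\<nu>. \<nu> \<subseteq># add_mset x \<mu>}"
    then have \<nu>: "\<nu> \<subseteq># add_mset x \<mu>" by simp
    show "\<nu> \<in> {\<nu>. \<nu> \<subseteq># \<mu>} \<union> add_mset x ` {\<nu>. \<nu> \<subseteq># \<mu>}"
    proof (cases "x \<in># \<nu>")
      case True
      then obtain \<nu>' where "\<nu> = add_mset x \<nu>'" by (metis mset_add)
      then show ?thesis using \<nu> by auto
    next
      case False
      then show ?thesis using \<nu>
        by (metis (no_types, lifting) Un_iff diff_single_trivial mem_Collect_eq subset_eq_diff_conv
            add_mset_add_single)
    qed
  qed
  then show ?case using add finite_subset by blast
qed simp

lemma finite_submsets_Collect [simp]: "finite {\<nu>. \<nu> \<subseteq># \<mu> \<and> P \<nu>}"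
  by (rule finite_subset[OF _ finite_submsets[of \<mu>]]) auto

lemma fcount_Nil [simp]: "fcount [] \<mu> = (if \<mu> = {#} then 1 else 0)"
  by (auto simp: fcount_def forests_def)

text \<open>
  The first tree is either empty, or a vertex whose two subtrees are two further trees of the forest.
\<close>
lemma fcount_Cons:
  "fcount (j # rs) \<mu> = fcount rs \<mu> + (if j \<in># \<mu> then fcount ((j - 1) # (j + 1) # rs) (\<mu> - {#j#}) else 0)"
proof -
  define g where "g ts = (case ts of l # r # ts' \<Rightarrow> Node l () r # ts' | _ \<Rightarrow> [])" for ts :: "unit tree list"
  let ?A = "forests ((j - 1) # (j + 1) # rs) (\<mu> - {#j#})"
  have g: "g (l # r # ts) = Node l () r # ts" for l r ts by (simp add: g_def)
  have eq: "forests (j # rs) \<mu> = (#) Leaf ` forests rs \<mu> \<union> (if j \<in># \<mu> then g ` ?A else {})"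
  proof (intro Set.equalityI subsetI)
    fix ts assume "ts \<in> forests (j # rs) \<mu>"
    then obtain t ts' where ts: "ts = t # ts'" "length ts' = length rs"
      "\<mu> = abscissae j t + forest_abscissae rs ts'"
      by (cases ts) (auto simp: forests_def)
    show "ts \<in> (#) Leaf ` forests rs \<mu> \<union> (if j \<in># \<mu> then g ` ?A else {})"
    proof (cases t)
      case Leaf
      then show ?thesis using ts by (auto simp: forests_def)
    next
      case (Node l x r)
      then have "l # r # ts' \<in> ?A" "ts = g (l # r # ts')" "j \<in># \<mu>"
        using ts by (auto simp: forests_def g add.assoc)
      then show ?thesis by auto
    qed
  next
    fix ts assume "ts \<in> (#) Leaf ` forests rs \<mu> \<union> (if j \<in># \<mu> then g ` ?A else {})"
    then consider "ts \<in> (#) Leaf ` forests rs \<mu>" | "j \<in># \<mu>" "ts \<in> g ` ?A"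
      by (auto split: if_splits)
    then show "ts \<in> forests (j # rs) \<mu>"
    proof cases
      case 1
      then show ?thesis by (auto simp: forests_def)
    next
      case 2
      then obtain us where us: "us \<in> ?A" "ts = g us" by auto
      then obtain l r us' where "us = l # r # us'"
        by (auto simp: forests_def length_Suc_conv)
      then show ?thesis using us 2 by (auto simp: forests_def g add.assoc)
    qed
  qed
  have inj: "inj_on g ?A"
    by (auto simp: inj_on_def forests_def length_Suc_conv g)
  have disj: "(#) Leaf ` forests rs \<mu> \<inter> g ` ?A = {}"
    by (auto simp: forests_def length_Suc_conv g)
  show ?thesis
    unfolding fcount_def eq
    using disj by (auto simp: card_Un_disjoint card_image inj)
qed

lemma fcount_append:
  "fcount (xs @ ys) \<mu> = (\<Sum>\<nu> | \<nu> \<subseteq># \<mu>. fcount xs \<nu> * fcount ys (\<mu> - \<nu>))"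
proof -
  let ?B = "\<lambda>\<nu>. forests xs \<nu> \<times> forests ys (\<mu> - \<nu>)"
  have eq: "forests (xs @ ys) \<mu> = (\<lambda>(a, b). a @ b) ` (\<Union>\<nu>\<in>{\<nu>. \<nu> \<subseteq># \<mu>}. ?B \<nu>)"
  proof (intro Set.equalityI subsetI)
    fix ts assume ts: "ts \<in> forests (xs @ ys) \<mu>"
    let ?a = "take (length xs) ts" and ?b = "drop (length xs) ts"
    have len: "length ?a = length xs" "length ?b = length ys"
      using ts by (auto simp: forests_def)
    have "forest_abscissae xs ?a + forest_abscissae ys ?b = \<mu>"
      using ts forest_abscissae_append[OF len(1), of ys ?b] by (simp add: forests_def)
    then have "(?a, ?b) \<in> ?B (forest_abscissae xs ?a)" "forest_abscissae xs ?a \<subseteq># \<mu>"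
      using len by (auto simp: forests_def)
    then have "(?a, ?b) \<in> (\<Union>\<nu>\<in>{\<nu>. \<nu> \<subseteq># \<mu>}. ?B \<nu>)" by blast
    then show "ts \<in> (\<lambda>(a, b). a @ b) ` (\<Union>\<nu>\<in>{\<nu>. \<nu> \<subseteq># \<mu>}. ?B \<nu>)"
      by (rule rev_image_eqI) simp
  qed (auto simp: forests_def forest_abscissae_append)
  have inj: "inj_on (\<lambda>(a, b). a @ b) (\<Union>\<nu>\<in>{\<nu>. \<nu> \<subseteq># \<mu>}. ?B \<nu>)"
    by (auto simp: inj_on_def forests_def)
  have "card (forests (xs @ ys) \<mu>) = card (\<Union>\<nu>\<in>{\<nu>. \<nu> \<subseteq># \<mu>}. ?B \<nu>)"
    unfolding eq by (rule card_image[OF inj])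
  also have "\<dots> = (\<Sum>\<nu> | \<nu> \<subseteq># \<mu>. card (?B \<nu>))"
  proof (rule card_UN_disjoint)
    show "\<forall>\<nu>\<in>{\<nu>. \<nu> \<subseteq># \<mu>}. finite (?B \<nu>)"
      by (intro ballI finite_cartesian_product finite_forests)
  qed (auto simp: forests_def)
  finally show ?thesis by (simp add: fcount_def card_cartesian_product)
qed

lemma diff_diff_submset: "\<nu> \<subseteq># \<mu> \<Longrightarrow> \<mu> - (\<mu> - \<nu>) = \<nu>"
  by (rule multiset_eqI) (simp add: mset_subset_eq_count)

lemma sum_submsets_reflect:
  "(\<Sum>\<nu> | \<nu> \<subseteq># \<mu>. f \<nu>) = (\<Sum>\<nu> | \<nu> \<subseteq># \<mu>. f (\<mu> - \<nu> :: 'b multiset))"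
  by (rule sum.reindex_bij_witness[of _ "\<lambda>\<nu>. \<mu> - \<nu>" "\<lambda>\<nu>. \<mu> - \<nu>"])
     (auto simp: diff_diff_submset)

lemma submset_diff_iff:
  assumes "\<kappa> \<subseteq># \<mu>"
  shows "\<nu> \<subseteq># \<mu> - \<kappa> \<longleftrightarrow> \<nu> \<subseteq># \<mu> \<and> \<nu> + \<kappa> \<subseteq># \<mu>"
proof -
  have "\<nu> \<subseteq># \<mu>" if "\<nu> + \<kappa> \<subseteq># \<mu>"
    using mset_subset_eq_add_left that by (rule subset_mset.order_trans)
  then show ?thesis using subset_mset.le_diff_conv2[OF assms, of \<nu>] by blast
qed

lemma sum_submsets_swap:
  "(\<Sum>\<kappa> | \<kappa> \<subseteq># \<mu>. \<Sum>\<nu> | \<nu> \<subseteq># \<mu> - \<kappa>. f \<kappa> \<nu>) = (\<Sum>\<nu> | \<nu> \<subseteq># \<mu>. \<Sum>\<kappa> | \<kappa> \<subseteq># \<mu> - \<nu>. f \<kappa> \<nu>)"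
proof -
  have *: "{\<nu>. \<nu> \<subseteq># \<mu> - \<kappa>} = {\<nu> \<in> {\<nu>. \<nu> \<subseteq># \<mu>}. \<kappa> + \<nu> \<subseteq># \<mu>}" if "\<kappa> \<subseteq># \<mu>" for \<kappa>
    using submset_diff_iff[OF that] by (auto simp: add.commute[of \<kappa>])
  have **: "{\<kappa>. \<kappa> \<subseteq># \<mu> - \<nu>} = {\<kappa> \<in> {\<nu>. \<nu> \<subseteq># \<mu>}. \<kappa> + \<nu> \<subseteq># \<mu>}" if "\<nu> \<subseteq># \<mu>" for \<nu>
    using submset_diff_iff[OF that] by auto
  have "(\<Sum>\<kappa> | \<kappa> \<subseteq># \<mu>. \<Sum>\<nu> | \<nu> \<subseteq># \<mu> - \<kappa>. f \<kappa> \<nu>)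
      = (\<Sum>\<kappa> | \<kappa> \<subseteq># \<mu>. \<Sum>\<nu> \<in> {\<nu> \<in> {\<nu>. \<nu> \<subseteq># \<mu>}. \<kappa> + \<nu> \<subseteq># \<mu>}. f \<kappa> \<nu>)"
    by (intro sum.cong refl) (simp add: *)
  also have "\<dots> = (\<Sum>\<nu> | \<nu> \<subseteq># \<mu>. \<Sum>\<kappa> \<in> {\<kappa> \<in> {\<nu>. \<nu> \<subseteq># \<mu>}. \<kappa> + \<nu> \<subseteq># \<mu>}. f \<kappa> \<nu>)"
    by (rule sum.swap_restrict) auto
  also have "\<dots> = (\<Sum>\<nu> | \<nu> \<subseteq># \<mu>. \<Sum>\<kappa> | \<kappa> \<subseteq># \<mu> - \<nu>. f \<kappa> \<nu>)"
    by (intro sum.cong refl) (simp add: **)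
  finally show ?thesis .
qed

lemma fcount_append_commute: "fcount (xs @ ys) \<mu> = fcount (ys @ xs) \<mu>"
proof -
  have "fcount (xs @ ys) \<mu> = (\<Sum>\<nu> | \<nu> \<subseteq># \<mu>. fcount xs (\<mu> - \<nu>) * fcount ys (\<mu> - (\<mu> - \<nu>)))"
    unfolding fcount_append by (subst sum_submsets_reflect) simp
  also have "\<dots> = (\<Sum>\<nu> | \<nu> \<subseteq># \<mu>. fcount ys \<nu> * fcount xs (\<mu> - \<nu>))"
    by (intro sum.cong refl) (simp add: diff_diff_submset mult.commute)
  finally show ?thesis by (simp add: fcount_append)
qed

lemma fcount_cong_mset: "mset xs = mset ys \<Longrightarrow> fcount xs \<mu> = fcount ys \<mu>"
proof (induction xs arbitrary: ys \<mu>)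
  case Nil
  then show ?case by simp
next
  case (Cons x xs)
  then have "x \<in> set ys" by (metis list.set_intros(1) mset_eq_setD)
  then obtain as bs where ys: "ys = as @ x # bs" by (meson split_list)
  have IH: "fcount xs \<nu> = fcount (bs @ as) \<nu>" for \<nu>
    using Cons.prems by (intro Cons.IH) (simp add: ys)
  have "fcount ys \<mu> = fcount ((x # bs) @ as) \<mu>"
    unfolding ys by (rule fcount_append_commute)
  also have "\<dots> = fcount ([x] @ (bs @ as)) \<mu>" by simp
  also have "\<dots> = fcount ([x] @ xs) \<mu>" by (subst (1 2) fcount_append) (simp add: IH)
  finally show ?case by simp
qed

lemma fcount_drop: "i \<notin># \<mu> \<Longrightarrow> fcount (i # rs) \<mu> = fcount rs \<mu>"
  by (simp add: fcount_Cons)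

lemma fcount_replicate_drop: "i \<notin># \<mu> \<Longrightarrow> fcount (rs @ replicate a i) \<mu> = fcount rs \<mu>"
proof -
  assume i: "i \<notin># \<mu>"
  have "fcount (replicate a i @ rs) \<mu> = fcount rs \<mu>"
    by (induction a) (simp_all add: fcount_drop i)
  then show ?thesis using fcount_append_commute[of rs] by metis
qed

text \<open>
  Cutting a forest at abscissa \<open>i\<close>: deleting the vertices of abscissa \<open>i\<close> with all their
  descendants leaves a forest with abscissae \<open>\<nu>\<close> avoiding \<open>i\<close>. The deleted parts are trees planted
  at \<open>i\<close>; the slots for them are the roots at \<open>i\<close>, the left slots of the vertices at \<open>i + 1\<close> and the
  right slots of the vertices at \<open>i - 1\<close>.
\<close>
lemma fcount_cut:
  "fcount rs \<mu> = (\<Sum>\<nu> | \<nu> \<subseteq># \<mu> \<and> i \<notin># \<nu>. fcount rs \<nu> *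
     fcount (replicate (count_list rs i + count \<nu> (i - 1) + count \<nu> (i + 1)) i) (\<mu> - \<nu>))"
proof (induction "2 * size \<mu> + length rs" arbitrary: \<mu> rs rule: less_induct)
  case less
  let ?rep = "\<lambda>rs \<nu>. replicate (count_list rs i + count \<nu> (i - 1) + count \<nu> (i + 1)) i"
  show ?case
  proof (cases rs)
    case Nil
    have "(\<Sum>\<nu> | \<nu> \<subseteq># \<mu> \<and> i \<notin># \<nu>. fcount rs \<nu> * fcount (?rep rs \<nu>) (\<mu> - \<nu>))
       = (\<Sum>\<nu> | \<nu> = {#}. fcount rs \<nu> * fcount (?rep rs \<nu>) (\<mu> - \<nu>))"
      by (rule sum.mono_neutral_right) (auto simp: Nil)
    then show ?thesis by (simp add: Nil)
  next
    case (Cons j rs')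
    show ?thesis
    proof (cases "j = i")
      case True
      have IH: "fcount rs' (\<mu> - \<kappa>) =
        (\<Sum>\<nu> | \<nu> \<subseteq># \<mu> - \<kappa>. if i \<in># \<nu> then 0 else fcount rs' \<nu> * fcount (?rep rs' \<nu>) (\<mu> - \<kappa> - \<nu>))"
        if "\<kappa> \<subseteq># \<mu>" for \<kappa>
      proof -
        have "size (\<mu> - \<kappa>) \<le> size \<mu>" by (simp add: size_mset_mono)
        then have "fcount rs' (\<mu> - \<kappa>) =
          (\<Sum>\<nu> | \<nu> \<subseteq># \<mu> - \<kappa> \<and> i \<notin># \<nu>. fcount rs' \<nu> * fcount (?rep rs' \<nu>) (\<mu> - \<kappa> - \<nu>))"
          by (intro less) (simp add: Cons)
        also have "\<dots> = (\<Sum>\<nu> | \<nu> \<subseteq># \<mu> - \<kappa>. if i \<in># \<nu> then 0 else fcount rs' \<nu> * fcount (?rep rs' \<nu>) (\<mu> - \<kappa> - \<nu>))"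
          by (rule sum.mono_neutral_cong_left) auto
        finally show ?thesis .
      qed
      have "fcount rs \<mu> = fcount ([i] @ rs') \<mu>" by (simp add: Cons True)
      also have "\<dots> = (\<Sum>\<kappa> | \<kappa> \<subseteq># \<mu>. fcount [i] \<kappa> *
          (\<Sum>\<nu> | \<nu> \<subseteq># \<mu> - \<kappa>. if i \<in># \<nu> then 0 else fcount rs' \<nu> * fcount (?rep rs' \<nu>) (\<mu> - \<kappa> - \<nu>)))"
        unfolding fcount_append by (intro sum.cong refl) (simp add: IH)
      also have "\<dots> = (\<Sum>\<nu> | \<nu> \<subseteq># \<mu>. \<Sum>\<kappa> | \<kappa> \<subseteq># \<mu> - \<nu>. fcount [i] \<kappa> *
          (if i \<in># \<nu> then 0 else fcount rs' \<nu> * fcount (?rep rs' \<nu>) (\<mu> - \<kappa> - \<nu>)))"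
        unfolding sum_distrib_left by (rule sum_submsets_swap)
      also have "\<dots> = (\<Sum>\<nu> | \<nu> \<subseteq># \<mu>. if i \<in># \<nu> then 0 else
          fcount rs' \<nu> * (\<Sum>\<kappa> | \<kappa> \<subseteq># \<mu> - \<nu>. fcount [i] \<kappa> * fcount (?rep rs' \<nu>) (\<mu> - \<nu> - \<kappa>)))"
      proof (intro sum.cong refl)
        fix \<nu>
        have "(\<Sum>\<kappa> | \<kappa> \<subseteq># \<mu> - \<nu>. fcount [i] \<kappa> * (fcount rs' \<nu> * fcount (?rep rs' \<nu>) (\<mu> - \<kappa> - \<nu>))) =
          fcount rs' \<nu> * (\<Sum>\<kappa> | \<kappa> \<subseteq># \<mu> - \<nu>. fcount [i] \<kappa> * fcount (?rep rs' \<nu>) (\<mu> - \<nu> - \<kappa>))"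
          unfolding sum_distrib_left
          by (intro sum.cong refl, subst diff_right_commute) (simp only: mult.left_commute)
        then show "(\<Sum>\<kappa> | \<kappa> \<subseteq># \<mu> - \<nu>. fcount [i] \<kappa> *
            (if i \<in># \<nu> then 0 else fcount rs' \<nu> * fcount (?rep rs' \<nu>) (\<mu> - \<kappa> - \<nu>))) =
          (if i \<in># \<nu> then 0 else
            fcount rs' \<nu> * (\<Sum>\<kappa> | \<kappa> \<subseteq># \<mu> - \<nu>. fcount [i] \<kappa> * fcount (?rep rs' \<nu>) (\<mu> - \<nu> - \<kappa>)))"
          by (cases "i \<in># \<nu>") simp_all
      qed
      also have "\<dots> = (\<Sum>\<nu> | \<nu> \<subseteq># \<mu>. if i \<in># \<nu> then 0 else fcount rs \<nu> * fcount (?rep rs \<nu>) (\<mu> - \<nu>))"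
        unfolding fcount_append[symmetric]
        by (intro sum.cong refl) (auto simp: Cons True fcount_drop)
      also have "\<dots> = (\<Sum>\<nu> | \<nu> \<subseteq># \<mu> \<and> i \<notin># \<nu>. fcount rs \<nu> * fcount (?rep rs \<nu>) (\<mu> - \<nu>))"
        by (rule sum.mono_neutral_cong_right) auto
      finally show ?thesis .
    next
      case False
      let ?rs = "(j - 1) # (j + 1) # rs'"
      let ?G = "\<lambda>\<nu>. fcount (?rep rs \<nu>) (\<mu> - \<nu>)"
      let ?A = "{\<nu>. \<nu> \<subseteq># \<mu> \<and> i \<notin># \<nu>}"
      have 1: "fcount rs' \<mu> = (\<Sum>\<nu> \<in> ?A. fcount rs' \<nu> * ?G \<nu>)"
      proof -
        have "fcount rs' \<mu> = (\<Sum>\<nu> \<in> ?A. fcount rs' \<nu> * fcount (?rep rs' \<nu>) (\<mu> - \<nu>))"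
          by (rule less) (simp add: Cons)
        then show ?thesis using False by (simp add: Cons)
      qed
      have 2: "(if j \<in># \<mu> then fcount ?rs (\<mu> - {#j#}) else 0) =
        (\<Sum>\<nu> \<in> ?A. (if j \<in># \<nu> then fcount ?rs (\<nu> - {#j#}) else 0) * ?G \<nu>)"
      proof (cases "j \<in># \<mu>")
        case j: True
        let ?B = "{\<nu>. \<nu> \<subseteq># \<mu> - {#j#} \<and> i \<notin># \<nu>}"
        have "fcount ?rs (\<mu> - {#j#}) =
           (\<Sum>\<nu> \<in> ?B. fcount ?rs \<nu> * fcount (?rep ?rs \<nu>) (\<mu> - {#j#} - \<nu>))"
        proof (rule less)
          have "size \<mu> = Suc (size (\<mu> - {#j#}))" using j
            by (metis size_Suc_Diff1)
          then show "2 * size (\<mu> - {#j#}) + length ?rs < 2 * size \<mu> + length rs"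
            by (simp add: Cons)
        qed
        also have "\<dots> = (\<Sum>\<nu> \<in> {\<nu> \<in> ?A. j \<in># \<nu>}. fcount ?rs (\<nu> - {#j#}) * ?G \<nu>)"
        proof (rule sum.reindex_bij_witness[of _ "\<lambda>\<nu>. \<nu> - {#j#}" "add_mset j"])
          fix \<nu> assume \<nu>: "\<nu> \<in> ?B"
          have "add_mset j \<nu> \<subseteq># \<mu>" using \<nu> j
            by (metis (no_types, lifting) insert_DiffM mem_Collect_eq mset_subset_eq_add_mset_cancel)
          then show "add_mset j \<nu> \<in> {\<nu> \<in> ?A. j \<in># \<nu>}" using \<nu> False by auto
          have "?rep ?rs \<nu> = ?rep rs (add_mset j \<nu>)"
            using False by (auto simp: Cons)
          then show "fcount ?rs (add_mset j \<nu> - {#j#}) * ?G (add_mset j \<nu>) =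
            fcount ?rs \<nu> * fcount (?rep ?rs \<nu>) (\<mu> - {#j#} - \<nu>)"
            by simp
        next
          fix \<nu> assume \<nu>: "\<nu> \<in> {\<nu> \<in> ?A. j \<in># \<nu>}"
          then have "\<nu> - {#j#} \<subseteq># \<mu> - {#j#}"
            by (intro mset_subset_eqI) (simp add: diff_le_mono mset_subset_eq_count)
          then show "\<nu> - {#j#} \<in> ?B"
            using \<nu> by (auto dest: in_diffD)
        qed auto
        also have "\<dots> = (\<Sum>\<nu> \<in> ?A. (if j \<in># \<nu> then fcount ?rs (\<nu> - {#j#}) else 0) * ?G \<nu>)"
          by (rule sum.mono_neutral_cong_left) auto
        finally show ?thesis using j by simp
      next
        case False
        then have "j \<notin># \<nu>" if "\<nu> \<subseteq># \<mu>" for \<nu> using mset_subset_eqD[OF that] by metis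
        then have "(\<Sum>\<nu> \<in> ?A. (if j \<in># \<nu> then fcount ?rs (\<nu> - {#j#}) else 0) * ?G \<nu>) = 0"
          by (intro sum.neutral) simp
        then show ?thesis using False by simp
      qed
      have "fcount rs \<mu> = (\<Sum>\<nu> \<in> ?A. fcount rs' \<nu> * ?G \<nu>) +
          (\<Sum>\<nu> \<in> ?A. (if j \<in># \<nu> then fcount ?rs (\<nu> - {#j#}) else 0) * ?G \<nu>)"
        unfolding 1[symmetric] 2[symmetric] unfolding Cons by (rule fcount_Cons)
      also have "\<dots> = (\<Sum>\<nu> \<in> ?A. fcount rs \<nu> * ?G \<nu>)"
        unfolding sum.distrib[symmetric] distrib_right[symmetric]
        unfolding Cons fcount_Cons[of j rs'] ..
      finally show ?thesis .
    qed
  qed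
qed

section \<open>Forests with all roots at one abscissa\<close>

text \<open>
  Among the forests with abscissae \<open>\<nu>\<close> that consist of \<open>Suc c\<close> consecutive forests with roots \<open>xs\<close>,
  an additive statistic \<open>s\<close> of the first block has average \<open>s \<nu> / Suc c\<close>, because the blocks are
  exchangeable.
\<close>
lemma fcount_power_exchange:
  fixes s :: "int multiset \<Rightarrow> nat"
  assumes s: "\<And>\<alpha> \<beta>. s (\<alpha> + \<beta>) = s \<alpha> + s \<beta>"
  shows "Suc c * (\<Sum>\<kappa> | \<kappa> \<subseteq># \<nu>. s \<kappa> * fcount xs \<kappa> * fcount (concat (replicate c xs)) (\<nu> - \<kappa>)) =
         s \<nu> * fcount (concat (replicate (Suc c) xs)) \<nu>"
proof (induction c arbitrary: \<nu>)
  case 0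
  have "(\<Sum>\<kappa> | \<kappa> \<subseteq># \<nu>. s \<kappa> * fcount xs \<kappa> * fcount (concat (replicate 0 xs)) (\<nu> - \<kappa>)) =
        (\<Sum>\<kappa> | \<kappa> = \<nu>. s \<kappa> * fcount xs \<kappa>)"
    by (rule sum.mono_neutral_cong_right)
      (auto simp: Diff_eq_empty_iff_mset dest: subset_mset.antisym)
  then show ?case by simp
next
  case (Suc c)
  let ?w = "\<lambda>c. fcount (concat (replicate c xs))" and ?f = "fcount xs"
  have conv: "?w (Suc c) \<nu> = (\<Sum>\<kappa> | \<kappa> \<subseteq># \<nu>. ?f \<kappa> * ?w c (\<nu> - \<kappa>))" for c \<nu>
    by (simp add: fcount_append)
  have split: "s \<nu> = s \<kappa> + s (\<nu> - \<kappa>)" if "\<kappa> \<subseteq># \<nu>" for \<kappa>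
    using s[of \<kappa> "\<nu> - \<kappa>"] that by (simp add: subset_mset.add_diff_inverse)
  have "s \<nu> * ?w (Suc (Suc c)) \<nu> = (\<Sum>\<kappa> | \<kappa> \<subseteq># \<nu>. s \<nu> * (?f \<kappa> * ?w (Suc c) (\<nu> - \<kappa>)))"
    unfolding conv[of "Suc c"] sum_distrib_left ..
  also have "\<dots> = (\<Sum>\<kappa> | \<kappa> \<subseteq># \<nu>. s \<kappa> * ?f \<kappa> * ?w (Suc c) (\<nu> - \<kappa>)
      + ?f \<kappa> * (s (\<nu> - \<kappa>) * ?w (Suc c) (\<nu> - \<kappa>)))"
  proof (intro sum.cong refl)
    fix \<kappa> assume "\<kappa> \<in> {\<kappa>. \<kappa> \<subseteq># \<nu>}"
    then have *: "s \<nu> = s \<kappa> + s (\<nu> - \<kappa>)" by (intro split) simp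
    show "s \<nu> * (?f \<kappa> * ?w (Suc c) (\<nu> - \<kappa>)) =
      s \<kappa> * ?f \<kappa> * ?w (Suc c) (\<nu> - \<kappa>) + ?f \<kappa> * (s (\<nu> - \<kappa>) * ?w (Suc c) (\<nu> - \<kappa>))"
      unfolding * by (simp only: algebra_simps)
  qed
  also have "\<dots> = (\<Sum>\<kappa> | \<kappa> \<subseteq># \<nu>. s \<kappa> * ?f \<kappa> * ?w (Suc c) (\<nu> - \<kappa>)) +
      (\<Sum>\<kappa> | \<kappa> \<subseteq># \<nu>. \<Sum>\<eta> | \<eta> \<subseteq># \<nu> - \<kappa>. Suc c * (?f \<kappa> * (s \<eta> * ?f \<eta> * ?w c (\<nu> - \<kappa> - \<eta>))))"
    unfolding sum.distrib Suc.IH[symmetric]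
    by (simp only: sum_distrib_left mult.left_commute)
  also have "(\<Sum>\<kappa> | \<kappa> \<subseteq># \<nu>. \<Sum>\<eta> | \<eta> \<subseteq># \<nu> - \<kappa>. Suc c * (?f \<kappa> * (s \<eta> * ?f \<eta> * ?w c (\<nu> - \<kappa> - \<eta>)))) =
     (\<Sum>\<eta> | \<eta> \<subseteq># \<nu>. \<Sum>\<kappa> | \<kappa> \<subseteq># \<nu> - \<eta>. Suc c * (?f \<kappa> * (s \<eta> * ?f \<eta> * ?w c (\<nu> - \<kappa> - \<eta>))))"
    by (rule sum_submsets_swap)
  also have "\<dots> = Suc c * (\<Sum>\<eta> | \<eta> \<subseteq># \<nu>. s \<eta> * ?f \<eta> * ?w (Suc c) (\<nu> - \<eta>))"
    unfolding conv[of c] sum_distrib_left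
    by (intro sum.cong refl) (simp only: ac_simps diff_right_commute)
  finally show ?case by simp
qed

text \<open>
  The first tree is empty, or it has a root at \<open>i\<close>; in the latter case \<open>\<kappa>\<close> collects the vertices
  that are joined to this root without passing through another vertex of abscissa \<open>i\<close>.
\<close>
lemma fcount_replicate_rec:
  fixes i :: int
  defines "s \<equiv> \<lambda>\<nu>. count \<nu> (i - 1) + count \<nu> (i + 1)"
  assumes "i \<in># \<mu>"
  shows "fcount (replicate (Suc a) i) \<mu> = fcount (replicate a i) \<mu> +
    (\<Sum>\<kappa> | \<kappa> \<subseteq># filter_mset (\<lambda>x. x \<noteq> i) \<mu>. fcount [i - 1, i + 1] \<kappa> *
       fcount (replicate (a + s \<kappa>) i) (\<mu> - {#i#} - \<kappa>))"
proof -
  have sets: "{\<nu>. \<nu> \<subseteq># \<mu> - {#i#} \<and> i \<notin># \<nu>} = {\<kappa>. \<kappa> \<subseteq># filter_mset (\<lambda>x. x \<noteq> i) \<mu>}"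
  proof (intro Collect_cong iffI)
    fix \<nu> assume *: "\<nu> \<subseteq># \<mu> - {#i#} \<and> i \<notin># \<nu>"
    show "\<nu> \<subseteq># filter_mset (\<lambda>x. x \<noteq> i) \<mu>"
    proof (rule mset_subset_eqI)
      fix x
      have "count \<nu> x \<le> count (\<mu> - {#i#}) x" "count \<nu> i = 0"
        using * mset_subset_eq_count[of \<nu> "\<mu> - {#i#}" x] by (auto simp: not_in_iff)
      then show "count \<nu> x \<le> count (filter_mset (\<lambda>x. x \<noteq> i) \<mu>) x" by (cases "x = i") simp_all
    qed
  next
    fix \<nu> assume *: "\<nu> \<subseteq># filter_mset (\<lambda>x. x \<noteq> i) \<mu>"
    have le: "count \<nu> x \<le> count (filter_mset (\<lambda>x. x \<noteq> i) \<mu>) x" for x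
      using * by (rule mset_subset_eq_count)
    have "count \<nu> x \<le> count (\<mu> - {#i#}) x" for x
      using le[of x] by (cases "x = i") auto
    then show "\<nu> \<subseteq># \<mu> - {#i#} \<and> i \<notin># \<nu>"
      using le[of i] by (auto simp: not_in_iff intro: mset_subset_eqI)
  qed
  have "fcount ([i - 1, i + 1] @ replicate a i) (\<mu> - {#i#}) =
    (\<Sum>\<kappa> | \<kappa> \<subseteq># filter_mset (\<lambda>x. x \<noteq> i) \<mu>. fcount [i - 1, i + 1] \<kappa> *
       fcount (replicate (a + s \<kappa>) i) (\<mu> - {#i#} - \<kappa>))"
    unfolding fcount_cut[of "[i - 1, i + 1] @ replicate a i" "\<mu> - {#i#}" i] sets
  proof (intro sum.cong refl)
    fix \<kappa> assume "\<kappa> \<in> {\<kappa>. \<kappa> \<subseteq># filter_mset (\<lambda>x. x \<noteq> i) \<mu>}"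
    then have i: "i \<notin># \<kappa>" using sets by auto
    have [simp]: "count_list (replicate a i) i = a" by (induction a) auto
    show "fcount ([i - 1, i + 1] @ replicate a i) \<kappa> *
      fcount (replicate (count_list ([i - 1, i + 1] @ replicate a i) i + count \<kappa> (i - 1) + count \<kappa> (i + 1)) i)
        (\<mu> - {#i#} - \<kappa>) =
      fcount [i - 1, i + 1] \<kappa> * fcount (replicate (a + s \<kappa>) i) (\<mu> - {#i#} - \<kappa>)"
      unfolding fcount_replicate_drop[OF i] by (simp add: s_def add.assoc)
  qed
  then show ?thesis using assms(2) by (simp add: fcount_Cons)
qed

lemma binomial_step: "(real n - real k) * real (n choose k) = real (Suc k) * real (n choose Suc k)"
proof (cases "k \<le> n")
  case True
  have "real (Suc k) * real (n choose Suc k) = real ((n - k) * (n choose k))"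
    by (simp only: binomial_absorption binomial_absorb_comp of_nat_mult[symmetric])
  then show ?thesis using True by (simp add: of_nat_diff)
qed (simp add: binomial_eq_0)

text \<open>
  A form of the cycle lemma. Let \<open>\<mu>\<close> have \<open>c = Suc d\<close> elements \<open>i\<close>. The right-hand count is that of
  the \<open>c\<close>-tuples of pairs of trees planted at \<open>i - 1\<close> and \<open>i + 1\<close>, which are to become what hangs
  between the vertices at \<open>i\<close>. Together with the \<open>a\<close> roots they offer \<open>a + s \<mu>\<close> slots at \<open>i\<close>, of which
  \<open>c\<close> have to be filled; among the \<open>(a + s \<mu>) choose c\<close> ways of doing so, the proportion
  \<open>a / (a + s \<mu>)\<close> yields a forest.
\<close>
lemma fcount_replicate:
  fixes i :: int
  defines "s \<equiv> \<lambda>\<nu>. count \<nu> (i - 1) + count \<nu> (i + 1)"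
  assumes "count \<mu> i = Suc d"
  shows "real (Suc d) * real (fcount (replicate a i) \<mu>) =
    real a * real ((a + s \<mu> - 1) choose d) *
    real (fcount (concat (replicate (Suc d) [i - 1, i + 1])) (filter_mset (\<lambda>x. x \<noteq> i) \<mu>))"
  using assms(2)
proof (induction d arbitrary: \<mu> a)
  case 0
  let ?\<rho> = "filter_mset (\<lambda>x. x \<noteq> i) \<mu>"
  have i: "i \<in># \<mu>" using 0 by (simp flip: count_greater_zero_iff)
  have \<rho>: "\<mu> - {#i#} = ?\<rho>"
    using 0 by (auto simp: multiset_eq_iff)
  have "fcount (replicate a i) \<mu> = a * fcount [i - 1, i + 1] ?\<rho>"
  proof (induction a)
    case 0
    then show ?case using i by auto
  next
    case (Suc a)
    have "(\<Sum>\<kappa> | \<kappa> \<subseteq># ?\<rho>. fcount [i - 1, i + 1] \<kappa> * fcount (replicate (a + s \<kappa>) i) (\<mu> - {#i#} - \<kappa>)) =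
       (\<Sum>\<kappa> | \<kappa> = ?\<rho>. fcount [i - 1, i + 1] \<kappa>)"
    proof (rule sum.mono_neutral_cong_right)
      fix \<kappa>
      have "i \<notin># ?\<rho> - \<kappa>" by (auto dest: in_diffD)
      then have *: "fcount (replicate (a + s \<kappa>) i) (\<mu> - {#i#} - \<kappa>) = (if ?\<rho> - \<kappa> = {#} then 1 else 0)"
        using fcount_replicate_drop[of i "?\<rho> - \<kappa>" "[]"] by (simp add: \<rho>)
      show "fcount [i - 1, i + 1] \<kappa> * fcount (replicate (a + s \<kappa>) i) (\<mu> - {#i#} - \<kappa>) = fcount [i - 1, i + 1] \<kappa>"
        if "\<kappa> \<in> {\<kappa>. \<kappa> = ?\<rho>}" using that * by simp
    next
      show "\<forall>\<kappa>\<in>{\<kappa>. \<kappa> \<subseteq># ?\<rho>} - {\<kappa>. \<kappa> = ?\<rho>}.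
        fcount [i - 1, i + 1] \<kappa> * fcount (replicate (a + s \<kappa>) i) (\<mu> - {#i#} - \<kappa>) = 0"
      proof
        fix \<kappa> assume \<kappa>: "\<kappa> \<in> {\<kappa>. \<kappa> \<subseteq># ?\<rho>} - {\<kappa>. \<kappa> = ?\<rho>}"
        have "i \<notin># ?\<rho> - \<kappa>" by (auto dest: in_diffD)
        moreover have "?\<rho> - \<kappa> \<noteq> {#}" using \<kappa> by (auto simp: Diff_eq_empty_iff_mset)
        ultimately show "fcount [i - 1, i + 1] \<kappa> * fcount (replicate (a + s \<kappa>) i) (\<mu> - {#i#} - \<kappa>) = 0"
          using fcount_replicate_drop[of i "?\<rho> - \<kappa>" "[]"] by (simp add: \<rho>)
      qed
    qed auto
    then show ?case
      using Suc fcount_replicate_rec[OF i, of a] by (simp add: s_def)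
  qed
  then show ?case by simp
next
  case (Suc d)
  let ?\<rho> = "filter_mset (\<lambda>x. x \<noteq> i) \<mu>"
  let ?w = "\<lambda>c. fcount (concat (replicate c [i - 1, i + 1]))"
  note outer_IH = Suc.IH and c = Suc.prems
  have i: "i \<in># \<mu>" using Suc.prems by (simp flip: count_greater_zero_iff)
  have s_add: "s (\<alpha> + \<beta>) = s \<alpha> + s \<beta>" for \<alpha> \<beta> by (simp add: s_def)
  have s\<rho>: "s ?\<rho> = s \<mu>" by (simp add: s_def)
  show ?case
  proof (induction a)
    case 0
    then show ?case using i by auto
  next
    case (Suc a)
    let ?N = "a + s \<mu> - 1"
    have IH: "real (Suc d) * real (fcount (replicate (a + s \<kappa>) i) (\<mu> - {#i#} - \<kappa>)) =
       (real a + real (s \<kappa>)) * real (?N choose d) * real (?w (Suc d) (?\<rho> - \<kappa>))"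
      if "\<kappa> \<subseteq># ?\<rho>" for \<kappa>
    proof -
      have le: "count \<kappa> x \<le> (if x = i then 0 else count \<mu> x)" for x
        using that by (auto simp: subseteq_mset_def dest: spec[of _ x])
      have "count \<kappa> i = 0" using le[of i] by simp
      then have 1: "count (\<mu> - {#i#} - \<kappa>) i = Suc d" using c by simp
      have 2: "filter_mset (\<lambda>x. x \<noteq> i) (\<mu> - {#i#} - \<kappa>) = ?\<rho> - \<kappa>"
        using le by (auto simp: multiset_eq_iff)
      have 3: "a + s \<kappa> + s (\<mu> - {#i#} - \<kappa>) = a + s \<mu>"
        using le[of "i - 1"] le[of "i + 1"] by (simp add: s_def)
      show ?thesis using outer_IH[OF 1, of "a + s \<kappa>"] unfolding 2 3 by simp
    qed
    define X where "X = (\<Sum>\<kappa> | \<kappa> \<subseteq># ?\<rho>. real (fcount [i - 1, i + 1] \<kappa>) *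
        real (fcount (replicate (a + s \<kappa>) i) (\<mu> - {#i#} - \<kappa>)))"
    have rec: "real (fcount (replicate (Suc a) i) \<mu>) = real (fcount (replicate a i) \<mu>) + X"
      using arg_cong[OF fcount_replicate_rec[OF i, of a], of real] by (simp add: X_def s_def)
    \<comment> \<open>after the first root, filled or not, \<open>a + s \<mu>\<close> slots remain whatever \<open>\<kappa>\<close> is; so the binomial
      coefficient leaves the sum over \<open>\<kappa>\<close> and only the average of \<open>s \<kappa>\<close> is needed\<close>
    define D where "D = (\<Sum>\<kappa> | \<kappa> \<subseteq># ?\<rho>. real (s \<kappa>) * real (fcount [i - 1, i + 1] \<kappa>) * real (?w (Suc d) (?\<rho> - \<kappa>)))"
    have D: "real (Suc (Suc d)) * D = real (s \<mu>) * real (?w (Suc (Suc d)) ?\<rho>)"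
      using arg_cong[OF fcount_power_exchange[OF s_add, where c = "Suc d" and \<nu> = ?\<rho> and xs = "[i - 1, i + 1]"], of real]
      unfolding s\<rho> D_def by (simp only: of_nat_mult of_nat_sum)
    have E: "real (?w (Suc (Suc d)) ?\<rho>) = (\<Sum>\<kappa> | \<kappa> \<subseteq># ?\<rho>. real (fcount [i - 1, i + 1] \<kappa>) * real (?w (Suc d) (?\<rho> - \<kappa>)))"
      by (subst replicate_Suc, subst concat.simps(2), subst fcount_append) simp
    have "real (Suc d) * X = (\<Sum>\<kappa> | \<kappa> \<subseteq># ?\<rho>. real (fcount [i - 1, i + 1] \<kappa>) *
        ((real a + real (s \<kappa>)) * real (?N choose d) * real (?w (Suc d) (?\<rho> - \<kappa>))))"
      unfolding X_def sum_distrib_left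
      by (intro sum.cong refl) (subst IH[symmetric], auto simp del: replicate.simps of_nat_Suc)
    also have "\<dots> = real (?N choose d) * (real a * real (?w (Suc (Suc d)) ?\<rho>) + D)"
      unfolding E D_def sum_distrib_left sum.distrib[symmetric]
      by (intro sum.cong refl) (simp add: algebra_simps del: replicate.simps)
    finally have X: "real (Suc d) * X = real (?N choose d) * (real a * real (?w (Suc (Suc d)) ?\<rho>) + D)" .
    define w where "w = real (?w (Suc (Suc d)) ?\<rho>)"
    have "real (Suc d) * (real (Suc (Suc d)) * real (fcount (replicate (Suc a) i) \<mu>)) =
      real (Suc d) * (real (Suc (Suc d)) * real (fcount (replicate a i) \<mu>)) + real (Suc (Suc d)) * (real (Suc d) * X)"
      unfolding rec by (simp only: algebra_simps)
    also have "\<dots> = real (Suc d) * (real a * real (?N choose Suc d) * w) +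
        real (?N choose d) * (real (Suc (Suc d)) * real a * w + real (Suc (Suc d)) * D)"
      unfolding X Suc.IH w_def by (simp only: algebra_simps)
    also have "\<dots> = w * (real a * (real (Suc d) * real (?N choose Suc d)) +
        real (?N choose d) * (real (Suc (Suc d)) * real a + real (s \<mu>)))"
      unfolding D w_def by (simp only: algebra_simps)
    also have "\<dots> = real (Suc d) * (real (Suc a) * real ((Suc a + s \<mu> - 1) choose Suc d) * w)"
    proof (cases "a + s \<mu>")
      case 0
      then show ?thesis by simp
    next
      case (Suc N)
      then have sum: "real a + real (s \<mu>) = real N + 1" by linarith
      have "real (Suc d) * real (Suc N choose Suc d) =
          real (Suc d) * real (N choose d) + (real N - real d) * real (N choose d)"
        unfolding binomial_step by (simp add: algebra_simps)
      then have b2: "real (Suc d) * real (Suc N choose Suc d) = (real N + 1) * real (N choose d)"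
        by (simp add: algebra_simps)
      have "real a * ((real N - real d) * real (N choose d)) +
        real (N choose d) * (real (Suc (Suc d)) * real a + real (s \<mu>)) =
        real (N choose d) * (real a * (real N + 1) + (real a + real (s \<mu>)))"
        by (simp add: algebra_simps)
      also have "\<dots> = real (Suc a) * ((real N + 1) * real (N choose d))"
        unfolding sum by (simp add: algebra_simps)
      finally have "real a * (real (Suc d) * real (N choose Suc d)) +
        real (N choose d) * (real (Suc (Suc d)) * real a + real (s \<mu>)) =
        real (Suc a) * (real (Suc d) * real (Suc N choose Suc d))"
        unfolding b2 binomial_step[of N d, symmetric] .
      then show ?thesis using Suc by simp
    qed
    finally show ?case unfolding w_def by (simp only: mult_cancel_left) simp
  qed
qed

section \<open>Peeling off the abscissae one at a time\<close>

text \<open>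
  Abscissae change by one along an edge, so a tree that avoids an abscissa stays on one side of it.
\<close>
lemma abscissae_less:
  "j < i \<Longrightarrow> i \<notin># abscissae j T \<Longrightarrow> x \<in># abscissae j T \<Longrightarrow> x < i"
proof (induction T arbitrary: j)
  case (Node l y r)
  show ?case
  proof (cases "j + 1 = i")
    case True
    then have "r = Leaf" using Node.prems(2) by (cases r) auto
    then show ?thesis using Node.IH(1)[of "j - 1"] Node.prems by auto
  next
    case False
    then show ?thesis using Node.IH(1)[of "j - 1"] Node.IH(2)[of "j + 1"] Node.prems by auto
  qed
qed simp

lemma abscissae_greater:
  "i < j \<Longrightarrow> i \<notin># abscissae j T \<Longrightarrow> x \<in># abscissae j T \<Longrightarrow> i < x"
proof (induction T arbitrary: j)
  case (Node l y r)
  show ?case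
  proof (cases "j - 1 = i")
    case True
    then have "l = Leaf" using Node.prems(2) by (cases l) auto
    then show ?thesis using Node.IH(2)[of "j + 1"] Node.prems by auto
  next
    case False
    then show ?thesis using Node.IH(1)[of "j - 1"] Node.IH(2)[of "j + 1"] Node.prems by auto
  qed
qed simp

lemma forest_abscissae_mem:
  assumes "length ts = length rs" "x \<in># forest_abscissae rs ts"
  obtains r t where "r \<in> set rs" "t \<in> set ts" "x \<in># abscissae r t"
    "abscissae r t \<subseteq># forest_abscissae rs ts"
proof -
  have "\<exists>r t. r \<in> set rs \<and> t \<in> set ts \<and> x \<in># abscissae r t \<and> abscissae r t \<subseteq># forest_abscissae rs ts"
    using assms
  proof (induction ts rs rule: list_induct2)
    case (Cons t ts r rs)
    then consider "x \<in># abscissae r t" | "x \<in># forest_abscissae rs ts" by auto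
    then show ?case
    proof cases
      case 1
      then show ?thesis by (intro exI[of _ r] exI[of _ t]) auto
    next
      case 2
      then obtain r' t' where "r' \<in> set rs" "t' \<in> set ts" "x \<in># abscissae r' t'"
        "abscissae r' t' \<subseteq># forest_abscissae rs ts"
        using Cons.IH by blast
      then show ?thesis
        by (intro exI[of _ r'] exI[of _ t']) (auto intro: subset_mset.add_increasing)
    qed
  qed simp
  then show ?thesis using that by blast
qed

lemma fcount_support:
  assumes "fcount rs \<kappa> \<noteq> 0" "i \<notin># \<kappa>" "x \<in># \<kappa>"
  shows "\<forall>r\<in>set rs. r < i \<Longrightarrow> x < i" and "\<forall>r\<in>set rs. i < r \<Longrightarrow> i < x"
proof -
  from assms(1) obtain ts where ts: "length ts = length rs" "forest_abscissae rs ts = \<kappa>"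
    unfolding fcount_def forests_def by (metis (mono_tags, lifting) card.empty empty_Collect_eq)
  then have "x \<in># forest_abscissae rs ts" using assms(3) by simp
  then obtain r t where rt: "r \<in> set rs" "t \<in> set ts" "x \<in># abscissae r t"
      "abscissae r t \<subseteq># forest_abscissae rs ts"
    by (rule forest_abscissae_mem[OF ts(1)])
  then have "i \<notin># abscissae r t" using assms(2) ts(2) mset_subset_eqD by metis
  then show "\<forall>r\<in>set rs. r < i \<Longrightarrow> x < i" and "\<forall>r\<in>set rs. i < r \<Longrightarrow> i < x"
    using rt(1,3) abscissae_less abscissae_greater by blast+
qed

lemma fcount_split:
  assumes xs: "\<forall>r\<in>set xs. r < i" and ys: "\<forall>r\<in>set ys. i < r" and i: "i \<notin># \<nu>"
  shows "fcount (xs @ ys) \<nu> =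
    fcount xs (filter_mset (\<lambda>x. x < i) \<nu>) * fcount ys (filter_mset (\<lambda>x. i < x) \<nu>)"
proof -
  let ?l = "filter_mset (\<lambda>x. x < i) \<nu>" and ?r = "filter_mset (\<lambda>x. i < x) \<nu>"
  have "fcount (xs @ ys) \<nu> = (\<Sum>\<kappa> | \<kappa> = ?l. fcount xs \<kappa> * fcount ys (\<nu> - \<kappa>))"
    unfolding fcount_append
  proof (rule sum.mono_neutral_right)
    show "\<forall>\<kappa>\<in>{\<kappa>. \<kappa> \<subseteq># \<nu>} - {\<kappa>. \<kappa> = ?l}. fcount xs \<kappa> * fcount ys (\<nu> - \<kappa>) = 0"
    proof (rule ballI, rule ccontr)
      fix \<kappa> assume "\<kappa> \<in> {\<kappa>. \<kappa> \<subseteq># \<nu>} - {\<kappa>. \<kappa> = ?l}"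
        and nz: "fcount xs \<kappa> * fcount ys (\<nu> - \<kappa>) \<noteq> 0"
      then have \<kappa>: "\<kappa> \<subseteq># \<nu>" "\<kappa> \<noteq> ?l" by auto
      have "i \<notin># \<kappa>" using i \<kappa>(1) mset_subset_eqD by metis
      then have 1: "x < i" if "x \<in># \<kappa>" for x
        using fcount_support(1)[OF _ _ that xs] nz by simp
      have "i \<notin># \<nu> - \<kappa>" using i by (auto dest: in_diffD)
      then have 2: "i < x" if "x \<in># \<nu> - \<kappa>" for x
        using fcount_support(2)[OF _ _ that ys] nz by simp
      have "\<kappa> = ?l"
      proof (rule multiset_eqI)
        fix x
        show "count \<kappa> x = count ?l x"
        proof (cases "x < i")
          case True
          then have "x \<notin># \<nu> - \<kappa>" using 2[of x] by auto
          then have "count (\<nu> - \<kappa>) x = 0" by (simp only: not_in_iff)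
          moreover have "count \<kappa> x \<le> count \<nu> x" using \<kappa>(1) by (rule mset_subset_eq_count)
          ultimately show ?thesis using True by simp
        next
          case False
          then have "x \<notin># \<kappa>" using 1[of x] by auto
          then have "count \<kappa> x = 0" by (simp only: not_in_iff)
          then show ?thesis using False by simp
        qed
      qed
      with \<kappa>(2) show False by simp
    qed
  qed auto
  also have "\<nu> - ?l = ?r" using i by (auto simp: multiset_eq_iff not_in_iff)
  ultimately show ?thesis by simp
qed

lemma fcount_concat_replicate:
  assumes "i \<notin># \<nu>"
  shows "fcount (concat (replicate c [i - 1, i + 1])) \<nu> =
    fcount (replicate c (i - 1)) (filter_mset (\<lambda>x. x < i) \<nu>) *
    fcount (replicate c (i + 1)) (filter_mset (\<lambda>x. i < x) \<nu>)"
proof -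
  have "mset (concat (replicate c [i - 1, i + 1])) = mset (replicate c (i - 1) @ replicate c (i + 1))"
    by (induction c) auto
  from fcount_cong_mset[OF this, of \<nu>] show ?thesis
    using fcount_split[OF _ _ assms, of "replicate c (i - 1)" "replicate c (i + 1)"]
    by simp
qed

lemma fcount_empty [simp]: "fcount rs {#} = 1"
  by (induction rs) (simp_all add: fcount_Cons)

lemma fcount_two_sided:
  assumes "\<mu> \<noteq> {#}"
  shows "real (fcount (replicate a i) \<mu>) = real a / real (count \<mu> i) *
    real ((a + (count \<mu> (i - 1) + count \<mu> (i + 1)) - 1) choose (count \<mu> i - 1)) *
    (real (fcount (replicate (count \<mu> i) (i - 1)) (filter_mset (\<lambda>x. x < i) \<mu>)) *
     real (fcount (replicate (count \<mu> i) (i + 1)) (filter_mset (\<lambda>x. i < x) \<mu>)))"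
proof (cases "count \<mu> i")
  case 0
  then have "fcount (replicate a i) \<mu> = 0"
    using fcount_replicate_drop[of i \<mu> "[]" a] assms by (simp add: not_in_iff)
  then show ?thesis using 0 by simp
next
  case (Suc d)
  let ?\<rho> = "filter_mset (\<lambda>x. x \<noteq> i) \<mu>"
  have [simp]: "filter_mset (\<lambda>x. x < i) ?\<rho> = filter_mset (\<lambda>x. x < i) \<mu>"
    "filter_mset (\<lambda>x. i < x) ?\<rho> = filter_mset (\<lambda>x. i < x) \<mu>"
    by (auto simp: multiset_eq_iff)
  have "i \<notin># ?\<rho>" by simp
  from fcount_concat_replicate[OF this, of "Suc d"] fcount_replicate[OF Suc, of a]
  show ?thesis
    unfolding Suc by (simp add: field_simps del: replicate.simps of_nat_Suc)
qed

text \<open>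
  On one side of the root, measured by the sign \<open>\<epsilon>\<close>, the vertices at \<open>\<epsilon> * k\<close> are peeled off and the
  next abscissa takes over. Division by zero covers the case without vertices at \<open>\<epsilon> * k\<close>, where
  both sides vanish.
\<close>
lemma fcount_one_sided:
  assumes \<epsilon>: "\<epsilon> \<in> {1, -1 :: int}" and ne: "\<mu> \<noteq> {#}" and supp: "\<And>x. x \<in># \<mu> \<Longrightarrow> k \<le> \<epsilon> * x"
  shows "real (fcount (replicate a (\<epsilon> * k)) \<mu>) = real a / real (count \<mu> (\<epsilon> * k)) *
    real ((a + count \<mu> (\<epsilon> * (k + 1)) - 1) choose (count \<mu> (\<epsilon> * k) - 1)) *
    real (fcount (replicate (count \<mu> (\<epsilon> * k)) (\<epsilon> * (k + 1))) (filter_mset (\<lambda>x. k + 1 \<le> \<epsilon> * x) \<mu>))"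
proof (cases "\<epsilon> = 1")
  case True
  have "count \<mu> (k - 1) = 0" using supp[of "k - 1"] True by (auto simp: not_in_iff[symmetric])
  moreover have e: "filter_mset (\<lambda>x. x < k) \<mu> = {#}"
    using supp True by fastforce
  moreover have f: "filter_mset (\<lambda>x. k < x) \<mu> = filter_mset (\<lambda>x. k + 1 \<le> x) \<mu>"
    by (rule filter_mset_cong) auto
  ultimately show ?thesis using fcount_two_sided[OF ne, of a k, unfolded e f] True by simp
next
  case False
  then have \<epsilon>: "\<epsilon> = -1" using \<epsilon> by simp
  have "count \<mu> (- k + 1) = 0" using supp[of "- k + 1"] \<epsilon> by (auto simp: not_in_iff[symmetric])
  moreover have e: "filter_mset (\<lambda>x. - k < x) \<mu> = {#}"
    using supp \<epsilon> by fastforce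
  moreover have f: "filter_mset (\<lambda>x. x < - k) \<mu> = filter_mset (\<lambda>x. k + 1 \<le> - x) \<mu>"
    by (rule filter_mset_cong) auto
  ultimately show ?thesis using fcount_two_sided[OF ne, of a "- k", unfolded e f] \<epsilon> by simp
qed

text \<open>
  The factor \<open>F\<close> collects what has been peeled off. Each step involves the number of vertices at
  three consecutive abscissae, which is why \<open>F\<close> depends on the vertices up to \<open>\<epsilon> * k\<close> inclusive.
\<close>
lemma fcount_root_peel:
  fixes \<epsilon> k :: int
  assumes \<epsilon>: "\<epsilon> \<in> {1, -1}" and k: "1 \<le> k"
  shows "\<exists>F. \<forall>\<mu>. filter_mset (\<lambda>x. k \<le> \<epsilon> * x) \<mu> \<noteq> {#} \<longrightarrow>
    real (fcount [0] \<mu>) = F (filter_mset (\<lambda>x. \<epsilon> * x \<le> k) \<mu>) *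
      real (fcount (replicate (count \<mu> (\<epsilon> * (k - 1))) (\<epsilon> * k)) (filter_mset (\<lambda>x. k \<le> \<epsilon> * x) \<mu>))"
  using k
proof (induction k rule: int_ge_induct)
  case base
  define F where "F \<rho> = real ((count \<rho> (-1) + count \<rho> 1) choose (count \<rho> 0 - 1)) / real (count \<rho> 0) *
    real (fcount (replicate (count \<rho> 0) (- \<epsilon>)) (filter_mset (\<lambda>x. \<epsilon> * x \<le> -1) \<rho>))" for \<rho>
  have "real (fcount [0] \<mu>) = F (filter_mset (\<lambda>x. \<epsilon> * x \<le> 1) \<mu>) *
      real (fcount (replicate (count \<mu> (\<epsilon> * (1 - 1))) (\<epsilon> * 1)) (filter_mset (\<lambda>x. 1 \<le> \<epsilon> * x) \<mu>))"
    if ne: "filter_mset (\<lambda>x. 1 \<le> \<epsilon> * x) \<mu> \<noteq> {#}" for \<mu>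
  proof -
    have "\<mu> \<noteq> {#}" using ne by auto
    note two = fcount_two_sided[OF this, of 1 0]
    have f: "filter_mset (\<lambda>x. \<epsilon> * x \<le> -1) (filter_mset (\<lambda>x. \<epsilon> * x \<le> 1) \<mu>) = filter_mset (\<lambda>x. \<epsilon> * x \<le> -1) \<mu>"
      by (auto simp: multiset_eq_iff)
    show ?thesis
    proof (cases "\<epsilon> = 1")
      case True
      have "filter_mset (\<lambda>x. x < 0) \<mu> = filter_mset (\<lambda>x. \<epsilon> * x \<le> -1) \<mu>"
           "filter_mset (\<lambda>x. 0 < x) \<mu> = filter_mset (\<lambda>x. 1 \<le> \<epsilon> * x) \<mu>"
        using True by (auto intro!: filter_mset_cong)
      then show ?thesis using two f True by (simp add: F_def)
    next
      case False
      then have \<epsilon>: "\<epsilon> = -1" using \<epsilon> by simp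
      have "filter_mset (\<lambda>x. x < 0) \<mu> = filter_mset (\<lambda>x. 1 \<le> \<epsilon> * x) \<mu>"
           "filter_mset (\<lambda>x. 0 < x) \<mu> = filter_mset (\<lambda>x. \<epsilon> * x \<le> -1) \<mu>"
        using \<epsilon> by (auto intro!: filter_mset_cong)
      then show ?thesis using two f \<epsilon> by (simp add: F_def)
    qed
  qed
  then show ?case by blast
next
  case (step k)
  then obtain F where F: "filter_mset (\<lambda>x. k \<le> \<epsilon> * x) \<mu> \<noteq> {#} \<Longrightarrow>
    real (fcount [0] \<mu>) = F (filter_mset (\<lambda>x. \<epsilon> * x \<le> k) \<mu>) *
      real (fcount (replicate (count \<mu> (\<epsilon> * (k - 1))) (\<epsilon> * k)) (filter_mset (\<lambda>x. k \<le> \<epsilon> * x) \<mu>))" for \<mu>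
    by blast
  define G where "G \<rho> = F (filter_mset (\<lambda>x. \<epsilon> * x \<le> k) \<rho>) *
    (real (count \<rho> (\<epsilon> * (k - 1))) / real (count \<rho> (\<epsilon> * k)) *
     real ((count \<rho> (\<epsilon> * (k - 1)) + count \<rho> (\<epsilon> * (k + 1)) - 1) choose (count \<rho> (\<epsilon> * k) - 1)))" for \<rho>
  have "real (fcount [0] \<mu>) = G (filter_mset (\<lambda>x. \<epsilon> * x \<le> k + 1) \<mu>) *
      real (fcount (replicate (count \<mu> (\<epsilon> * k)) (\<epsilon> * (k + 1))) (filter_mset (\<lambda>x. k + 1 \<le> \<epsilon> * x) \<mu>))"
    if ne: "filter_mset (\<lambda>x. k + 1 \<le> \<epsilon> * x) \<mu> \<noteq> {#}" for \<mu>
  proof -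
    let ?\<rho> = "filter_mset (\<lambda>x. \<epsilon> * x \<le> k + 1) \<mu>" and ?\<mu> = "filter_mset (\<lambda>x. k \<le> \<epsilon> * x) \<mu>"
    have \<epsilon>\<epsilon>: "\<epsilon> * (\<epsilon> * x) = x" for x using \<epsilon> by auto
    have ne': "?\<mu> \<noteq> {#}" using ne by (auto simp: filter_mset_eq_mempty_iff)
    have c: "count ?\<rho> (\<epsilon> * (k - 1)) = count \<mu> (\<epsilon> * (k - 1))"
      "count ?\<rho> (\<epsilon> * k) = count \<mu> (\<epsilon> * k)"
      "count ?\<rho> (\<epsilon> * (k + 1)) = count \<mu> (\<epsilon> * (k + 1))"
      by (simp_all add: \<epsilon>\<epsilon>)
    have c': "count ?\<mu> (\<epsilon> * k) = count \<mu> (\<epsilon> * k)"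
      "count ?\<mu> (\<epsilon> * (k + 1)) = count \<mu> (\<epsilon> * (k + 1))"
      by (simp_all add: \<epsilon>\<epsilon>)
    have supp: "k \<le> \<epsilon> * x" if "x \<in># ?\<mu>" for x using that by simp
    have f: "filter_mset (\<lambda>x. \<epsilon> * x \<le> k) ?\<rho> = filter_mset (\<lambda>x. \<epsilon> * x \<le> k) \<mu>"
      by (auto simp: multiset_eq_iff)
    have f': "filter_mset (\<lambda>x. k + 1 \<le> \<epsilon> * x) ?\<mu> = filter_mset (\<lambda>x. k + 1 \<le> \<epsilon> * x) \<mu>"
      by (auto simp: multiset_eq_iff)
    have "real (fcount (replicate (count \<mu> (\<epsilon> * (k - 1))) (\<epsilon> * k)) ?\<mu>) =
      real (count \<mu> (\<epsilon> * (k - 1))) / real (count \<mu> (\<epsilon> * k)) *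
     real ((count \<mu> (\<epsilon> * (k - 1)) + count \<mu> (\<epsilon> * (k + 1)) - 1) choose (count \<mu> (\<epsilon> * k) - 1)) *
     real (fcount (replicate (count \<mu> (\<epsilon> * k)) (\<epsilon> * (k + 1))) (filter_mset (\<lambda>x. k + 1 \<le> \<epsilon> * x) \<mu>))"
      using fcount_one_sided[OF \<epsilon> ne' supp, of "count \<mu> (\<epsilon> * (k - 1))"] unfolding c' f' .
    then show ?thesis
      unfolding F[OF ne'] G_def f c by simp
  qed
  then show ?case by (intro exI[of _ G]) simp
qed

lemma prod_telescope_int:
  fixes f :: "int \<Rightarrow> real"
  assumes "p < q" "\<And>u. u \<in> {p..<q} \<Longrightarrow> f u \<noteq> 0"
  shows "(\<Prod>u\<in>{p..<q}. f (u - 1) / f u) = f (p - 1) / f (q - 1)"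
  using assms
proof (induction q rule: int_gr_induct)
  case base
  have "{p..<p + 1} = {p}" by auto
  then show ?case by simp
next
  case (step q)
  have "{p..<q + 1} = insert q {p..<q}" using step by auto
  moreover have "f (q - 1) \<noteq> 0" using step by simp
  ultimately show ?case using step by simp
qed

text \<open>
  The quotients of the numbers of vertices at consecutive abscissae, which the peeling produces
  next to the binomial coefficients, telescope.
\<close>
lemma fcount_root_product:
  fixes \<epsilon> p q :: int
  assumes \<epsilon>: "\<epsilon> \<in> {1, -1}" and p: "1 \<le> p" and pq: "p < q"
  shows "\<exists>F. \<forall>\<mu>. (\<forall>u\<in>{p..<q}. 0 < count \<mu> (\<epsilon> * u)) \<longrightarrow>
    real (fcount [0] \<mu>) = F (filter_mset (\<lambda>x. \<epsilon> * x \<le> p) \<mu>) *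
      (\<Prod>u\<in>{p..<q}. real ((count \<mu> (\<epsilon> * (u - 1)) + count \<mu> (\<epsilon> * (u + 1)) - 1) choose (count \<mu> (\<epsilon> * u) - 1))) *
      (real (count \<mu> (\<epsilon> * (p - 1))) / real (count \<mu> (\<epsilon> * (q - 1))) *
       real (fcount (replicate (count \<mu> (\<epsilon> * (q - 1))) (\<epsilon> * q)) (filter_mset (\<lambda>x. q \<le> \<epsilon> * x) \<mu>)))"
proof -
  obtain F where F: "filter_mset (\<lambda>x. p \<le> \<epsilon> * x) \<mu> \<noteq> {#} \<Longrightarrow>
    real (fcount [0] \<mu>) = F (filter_mset (\<lambda>x. \<epsilon> * x \<le> p) \<mu>) *
      real (fcount (replicate (count \<mu> (\<epsilon> * (p - 1))) (\<epsilon> * p)) (filter_mset (\<lambda>x. p \<le> \<epsilon> * x) \<mu>))" for \<mu>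
    using fcount_root_peel[OF \<epsilon> p] by blast
  have \<epsilon>\<epsilon>: "\<epsilon> * (\<epsilon> * x) = x" for x using \<epsilon> by auto
  show ?thesis
  proof (intro exI[of _ F] allI impI)
    fix \<mu> assume pos: "\<forall>u\<in>{p..<q}. 0 < count \<mu> (\<epsilon> * u)"
    define b where "b u = real ((count \<mu> (\<epsilon> * (u - 1)) + count \<mu> (\<epsilon> * (u + 1)) - 1) choose (count \<mu> (\<epsilon> * u) - 1))" for u
    define r where "r u = real (count \<mu> (\<epsilon> * u))" for u
    let ?T = "\<lambda>q. real (fcount (replicate (count \<mu> (\<epsilon> * (q - 1))) (\<epsilon> * q)) (filter_mset (\<lambda>x. q \<le> \<epsilon> * x) \<mu>))"
    have "r' \<le> q \<Longrightarrow> ?T p = (\<Prod>u\<in>{p..<r'}. r (u - 1) / r u * b u) * ?T r'" if "p \<le> r'" for r'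
      using that
    proof (induction r' rule: int_ge_induct)
      case (step v)
      let ?\<mu> = "filter_mset (\<lambda>x. v \<le> \<epsilon> * x) \<mu>"
      have "0 < count \<mu> (\<epsilon> * v)" using pos step by simp
      then have "0 < count ?\<mu> (\<epsilon> * v)" by (simp add: \<epsilon>\<epsilon>)
      then have ne: "?\<mu> \<noteq> {#}" by (metis count_empty less_irrefl)
      have c': "count ?\<mu> (\<epsilon> * v) = count \<mu> (\<epsilon> * v)"
        "count ?\<mu> (\<epsilon> * (v + 1)) = count \<mu> (\<epsilon> * (v + 1))"
        by (simp_all add: \<epsilon>\<epsilon>)
      have supp: "v \<le> \<epsilon> * x" if "x \<in># ?\<mu>" for x using that by simp
      have f': "filter_mset (\<lambda>x. v + 1 \<le> \<epsilon> * x) ?\<mu> = filter_mset (\<lambda>x. v + 1 \<le> \<epsilon> * x) \<mu>"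
        by (auto simp: multiset_eq_iff)
      have "?T v = r (v - 1) / r v * b v * ?T (v + 1)"
        using fcount_one_sided[OF \<epsilon> ne supp, of "count \<mu> (\<epsilon> * (v - 1))"]
        unfolding c' f' r_def b_def by simp
      moreover have "{p..<v + 1} = insert v {p..<v}" using step by auto
      ultimately show ?case using step by simp
    qed simp
    from this[of q] have "?T p = (\<Prod>u\<in>{p..<q}. r (u - 1) / r u) * (\<Prod>u\<in>{p..<q}. b u) * ?T q"
      using pq unfolding prod.distrib by simp
    also have "(\<Prod>u\<in>{p..<q}. r (u - 1) / r u) = r (p - 1) / r (q - 1)"
      using pos by (intro prod_telescope_int pq) (simp add: r_def)
    finally have T: "?T p = r (p - 1) / r (q - 1) * (\<Prod>u\<in>{p..<q}. b u) * ?T q" .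
    have "0 < count (filter_mset (\<lambda>x. p \<le> \<epsilon> * x) \<mu>) (\<epsilon> * p)" using pos pq by (simp add: \<epsilon>\<epsilon>)
    then have "filter_mset (\<lambda>x. p \<le> \<epsilon> * x) \<mu> \<noteq> {#}" by (metis count_empty less_irrefl)
    from F[OF this] T show "real (fcount [0] \<mu>) = F (filter_mset (\<lambda>x. \<epsilon> * x \<le> p) \<mu>) *
      (\<Prod>u\<in>{p..<q}. real ((count \<mu> (\<epsilon> * (u - 1)) + count \<mu> (\<epsilon> * (u + 1)) - 1) choose (count \<mu> (\<epsilon> * u) - 1))) *
      (real (count \<mu> (\<epsilon> * (p - 1))) / real (count \<mu> (\<epsilon> * (q - 1))) * ?T q)"
      unfolding b_def r_def by simp
  qed
qed

text \<open>
  The number of trees with given vertical profile. The dependence on the profile strictly between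
  \<open>k\<^sub>1\<close> and \<open>k\<^sub>2 - 1\<close> is entirely in the product. For \<open>k\<^sub>2 < 0\<close> the peeling runs from \<open>k\<^sub>2 - 1\<close> down to
  \<open>k\<^sub>1\<close> instead of from \<open>k\<^sub>1\<close> up to \<open>k\<^sub>2 - 1\<close>; the binomial coefficients are the same.
\<close>
lemma fcount_root_profile:
  fixes k\<^sub>1 k\<^sub>2 :: int
  assumes "0 < k\<^sub>1 \<and> k\<^sub>1 < k\<^sub>2 \<or> k\<^sub>1 < k\<^sub>2 \<and> k\<^sub>2 < 0"
  shows "\<exists>F. \<forall>\<mu>. (\<forall>j\<in>{k\<^sub>1..k\<^sub>2}. 0 < count \<mu> j) \<longrightarrow>
    real (fcount [0] \<mu>) = F (filter_mset (\<lambda>x. x \<le> k\<^sub>1 \<or> k\<^sub>2 - 1 \<le> x) \<mu>) *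
      (\<Prod>j\<in>{k\<^sub>1..<k\<^sub>2}. real ((count \<mu> (j - 1) + count \<mu> (j + 1) - 1) choose (count \<mu> j - 1)))"
  using assms
proof
  let ?P = "\<lambda>x. x \<le> k\<^sub>1 \<or> k\<^sub>2 - 1 \<le> x"
  assume k: "0 < k\<^sub>1 \<and> k\<^sub>1 < k\<^sub>2"
  then obtain F where F: "\<forall>u\<in>{k\<^sub>1..<k\<^sub>2}. 0 < count \<mu> u \<Longrightarrow>
    real (fcount [0] \<mu>) = F (filter_mset (\<lambda>x. x \<le> k\<^sub>1) \<mu>) *
      (\<Prod>u\<in>{k\<^sub>1..<k\<^sub>2}. real ((count \<mu> (u - 1) + count \<mu> (u + 1) - 1) choose (count \<mu> u - 1))) *
      (real (count \<mu> (k\<^sub>1 - 1)) / real (count \<mu> (k\<^sub>2 - 1)) *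
       real (fcount (replicate (count \<mu> (k\<^sub>2 - 1)) k\<^sub>2) (filter_mset (\<lambda>x. k\<^sub>2 \<le> x) \<mu>)))" for \<mu>
    using fcount_root_product[of 1 k\<^sub>1 k\<^sub>2] by auto
  define G where "G \<rho> = F (filter_mset (\<lambda>x. x \<le> k\<^sub>1) \<rho>) *
    (real (count \<rho> (k\<^sub>1 - 1)) / real (count \<rho> (k\<^sub>2 - 1)) *
       real (fcount (replicate (count \<rho> (k\<^sub>2 - 1)) k\<^sub>2) (filter_mset (\<lambda>x. k\<^sub>2 \<le> x) \<rho>)))" for \<rho>
  have f: "filter_mset (\<lambda>x. x \<le> k\<^sub>1) (filter_mset ?P \<mu>) = filter_mset (\<lambda>x. x \<le> k\<^sub>1) \<mu>"
    "filter_mset (\<lambda>x. k\<^sub>2 \<le> x) (filter_mset ?P \<mu>) = filter_mset (\<lambda>x. k\<^sub>2 \<le> x) \<mu>" for \<mu>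
    by (auto simp: multiset_eq_iff)
  show ?thesis
  proof (intro exI[of _ G] allI impI)
    fix \<mu> assume "\<forall>j\<in>{k\<^sub>1..k\<^sub>2}. 0 < count \<mu> j"
    then have "\<forall>u\<in>{k\<^sub>1..<k\<^sub>2}. 0 < count \<mu> u" by simp
    from F[OF this] show "real (fcount [0] \<mu>) = G (filter_mset ?P \<mu>) *
      (\<Prod>j\<in>{k\<^sub>1..<k\<^sub>2}. real ((count \<mu> (j - 1) + count \<mu> (j + 1) - 1) choose (count \<mu> j - 1)))"
      unfolding G_def f by simp
  qed
next
  let ?P = "\<lambda>x. x \<le> k\<^sub>1 \<or> k\<^sub>2 - 1 \<le> x"
  assume k: "k\<^sub>1 < k\<^sub>2 \<and> k\<^sub>2 < 0"
  \<comment> \<open>in the reflected coordinate \<open>u = - j\<close> the range \<open>{k\<^sub>1..<k\<^sub>2}\<close> of \<open>j\<close> becomes \<open>{1 - k\<^sub>2..<1 - k\<^sub>1}\<close>\<close>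
  let ?p = "1 - k\<^sub>2" and ?q = "1 - k\<^sub>1"
  from k obtain F where F: "\<forall>u\<in>{?p..<?q}. 0 < count \<mu> (- u) \<Longrightarrow>
    real (fcount [0] \<mu>) = F (filter_mset (\<lambda>x. - x \<le> ?p) \<mu>) *
      (\<Prod>u\<in>{?p..<?q}. real ((count \<mu> (- (u - 1)) + count \<mu> (- (u + 1)) - 1) choose (count \<mu> (- u) - 1))) *
      (real (count \<mu> (- (?p - 1))) / real (count \<mu> (- (?q - 1))) *
       real (fcount (replicate (count \<mu> (- (?q - 1))) (- ?q)) (filter_mset (\<lambda>x. ?q \<le> - x) \<mu>)))" for \<mu>
    using fcount_root_product[of "-1" ?p ?q] by auto
  define G where "G \<rho> = F (filter_mset (\<lambda>x. - x \<le> ?p) \<rho>) *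
    (real (count \<rho> k\<^sub>2) / real (count \<rho> k\<^sub>1) *
       real (fcount (replicate (count \<rho> k\<^sub>1) (- ?q)) (filter_mset (\<lambda>x. ?q \<le> - x) \<rho>)))" for \<rho>
  have f: "filter_mset (\<lambda>x. - x \<le> ?p) (filter_mset ?P \<mu>) = filter_mset (\<lambda>x. - x \<le> ?p) \<mu>"
    "filter_mset (\<lambda>x. ?q \<le> - x) (filter_mset ?P \<mu>) = filter_mset (\<lambda>x. ?q \<le> - x) \<mu>" for \<mu>
    by (auto simp: multiset_eq_iff)
  show ?thesis
  proof (intro exI[of _ G] allI impI)
    fix \<mu> assume pos: "\<forall>j\<in>{k\<^sub>1..k\<^sub>2}. 0 < count \<mu> j"
    then have pos: "\<forall>u\<in>{?p..<?q}. 0 < count \<mu> (- u)" by simp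
    have "(\<Prod>u\<in>{?p..<?q}. real ((count \<mu> (- (u - 1)) + count \<mu> (- (u + 1)) - 1) choose (count \<mu> (- u) - 1))) =
      (\<Prod>j\<in>{k\<^sub>1..<k\<^sub>2}. real ((count \<mu> (j - 1) + count \<mu> (j + 1) - 1) choose (count \<mu> j - 1)))"
      by (rule prod.reindex_bij_witness[of _ uminus uminus]) (auto simp: add.commute)
    with F[OF pos] show "real (fcount [0] \<mu>) = G (filter_mset ?P \<mu>) *
      (\<Prod>j\<in>{k\<^sub>1..<k\<^sub>2}. real ((count \<mu> (j - 1) + count \<mu> (j + 1) - 1) choose (count \<mu> j - 1)))"
      unfolding G_def f by simp
  qed
qed

section \<open>The companion chain\<close>

text \<open>
  The library's negative binomial variable counts failures; the sum of the \<open>c\<close> geometric variables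
  also counts the \<open>c\<close> successes.
\<close>
lemma map_pmf_sum_geom:
  "map_pmf (\<lambda>g. \<Sum>k = 1..c. g k) (Pi_pmf {1..c} 0 (\<lambda>_. geom)) =
   map_pmf (\<lambda>x. x + c) (neg_binomial_pmf c (1/2))"
proof (induction c)
  case 0
  then show ?case by simp
next
  case (Suc c)
  have "map_pmf (\<lambda>g. \<Sum>k = 1..Suc c. g k) (Pi_pmf {1..Suc c} 0 (\<lambda>_. geom)) =
    map_pmf (\<lambda>g. \<Sum>k = 1..Suc c. g k) (Pi_pmf (insert (Suc c) {1..c}) 0 (\<lambda>_. geom))"
    by (simp add: atLeastAtMostSuc_conv)
  also have "\<dots> = map_pmf (\<lambda>(y, f). y + (\<Sum>k = 1..c. f k)) (pair_pmf geom (Pi_pmf {1..c} 0 (\<lambda>_. geom)))"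
    by (subst Pi_pmf_insert) (auto simp: pmf.map_comp o_def case_prod_unfold intro!: map_pmf_cong)
  also have "\<dots> = map_pmf (\<lambda>(y, x). y + x) (pair_pmf geom (map_pmf (\<lambda>g. \<Sum>k = 1..c. g k) (Pi_pmf {1..c} 0 (\<lambda>_. geom))))"
    by (simp add: pair_map_pmf2 pmf.map_comp o_def case_prod_unfold)
  also have "\<dots> = map_pmf (\<lambda>x. x + Suc c) (neg_binomial_pmf (Suc c) (1/2))"
    unfolding Suc.IH unfolding geom_def neg_binomial_pmf_Suc
    by (simp add: pair_map_pmf1 pair_map_pmf2 pmf.map_comp o_def case_prod_unfold add_ac)
  finally show ?case .
qed

lemma companion_step_pos:
  assumes "m > 0"
  shows "companion_step (\<delta>, m, s) =
    map_pmf (\<lambda>x. (\<delta> + int x - m, \<delta> + int x, s + \<delta> + int x)) (neg_binomial_pmf (nat m) (1/2))"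
proof -
  let ?c = "nat m"
  have "companion_step (\<delta>, m, s) =
    map_pmf (\<lambda>S. (\<delta> + int S - 2 * m, \<delta> + int S - m, s + \<delta> + int S - m))
      (map_pmf (\<lambda>g. \<Sum>k = 1..?c. g k) (Pi_pmf {1..?c} 0 (\<lambda>_. geom)))"
    using assms unfolding companion_step_def
    by (auto simp: pmf.map_comp o_def Let_def sum_subtractf intro!: map_pmf_cong)
  then show ?thesis
    using assms unfolding map_pmf_sum_geom by (simp add: pmf.map_comp o_def algebra_simps)
qed

lemma pmf_companion_step:
  assumes m: "m > 0" and m': "m' > 0" and \<delta>: "\<delta> \<le> m"
  shows "pmf (companion_step (\<delta>, m, s)) (m' - m, m', s + m') =
    real ((nat (m - \<delta>) + nat m' - 1) choose (nat m - 1)) / 2 ^ (nat (m - \<delta>) + nat m')"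
proof (cases "\<delta> \<le> m'")
  case True
  let ?h = "\<lambda>x. (\<delta> + int x - m, \<delta> + int x, s + \<delta> + int x)"
  define x where "x = nat (m' - \<delta>)"
  define N where "N = nat (m - \<delta>) + nat m' - 1"
  have h: "(m' - m, m', s + m') = ?h x" using True by (simp add: x_def)
  have N: "x + nat m - 1 = N" "x + nat m = Suc N" "nat (m - \<delta>) + nat m' = Suc N" "N - x = nat m - 1" "x \<le> N"
    using assms True by (auto simp: x_def N_def)
  have "pmf (companion_step (\<delta>, m, s)) (?h x) = pmf (neg_binomial_pmf (nat m) (1/2)) x"
    unfolding companion_step_pos[OF m] by (rule pmf_map_inj') (auto simp: inj_on_def)
  also have "\<dots> = real (N choose x) * (1/2) ^ (x + nat m)"
    unfolding N(1)[symmetric] by (subst pmf_neg_binomial) (simp_all add: power_add)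
  also have "\<dots> = real (N choose (nat m - 1)) / 2 ^ Suc N"
    unfolding N(2) using binomial_symmetric[OF N(5)] N(4) by (simp add: power_one_over)
  finally show ?thesis unfolding h N(3) by simp
next
  case False
  have "(m' - m, m', s + m') \<notin> set_pmf (companion_step (\<delta>, m, s))"
    unfolding companion_step_pos[OF m] using False by auto
  then have "pmf (companion_step (\<delta>, m, s)) (m' - m, m', s + m') = 0"
    by (simp add: set_pmf_iff)
  moreover have "nat (m - \<delta>) + nat m' - 1 < nat m - 1"
    using False assms by linarith
  ultimately show ?thesis by (simp add: binomial_eq_0)
qed

lemma (in finite_measure) measure_proportional_on_fibres:
  fixes X :: "'a \<Rightarrow> 'b :: countable"
  assumes [measurable]: "X \<in> M \<rightarrow>\<^sub>M count_space UNIV" "A \<in> sets M" "B \<in> sets M"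
    and eq: "\<And>x. measure M (A \<inter> {\<omega> \<in> space M. X \<omega> = x}) = c * measure M (B \<inter> {\<omega> \<in> space M. X \<omega> = x})"
  shows "measure M A = c * measure M B"
proof -
  let ?F = "\<lambda>A n. A \<inter> {\<omega> \<in> space M. to_nat (X \<omega>) = n}"
  have sums: "(\<lambda>n. measure M (?F A n)) sums measure M A" if A: "A \<in> sets M" for A
  proof -
    have [measurable]: "A \<in> sets M" by (rule A)
    have "(\<lambda>n. measure M (?F A n)) sums measure M (\<Union>n. ?F A n)"
      by (rule finite_measure_UNION) (auto simp: disjoint_family_on_def)
    also have "(\<Union>n. ?F A n) = A" using sets.sets_into_space[OF A] by auto
    finally show ?thesis .
  qed
  have "measure M (?F A n) = c * measure M (?F B n)" for n
  proof (cases "\<exists>x :: 'b. to_nat x = n")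
    case True
    then obtain x :: 'b where "n = to_nat x" by auto
    then show ?thesis using eq[of x] by simp
  next
    case False
    then have "?F A n = {}" "?F B n = {}" by auto
    then show ?thesis by simp
  qed
  then have "(\<lambda>n. c * measure M (?F B n)) sums measure M A"
    using sums[OF assms(2)] by simp
  then show ?thesis
    using sums_mult[OF sums[OF assms(3)], of c] sums_unique2 by blast
qed

text \<open>
  The Markov property with respect to a part \<open>{l..k}\<close> of the past, obtained from that with respect to
  the whole past by summing over the values of \<open>Z\<close> at the times before \<open>l\<close>.
\<close>
lemma companion_markov:
  assumes cp: "companion_process P k\<^sub>0 Z" and l: "k\<^sub>0 \<le> l" and k: "l \<le> k"
  shows "\<P>(\<omega> in P. (\<forall>j\<in>{l..k}. Z j \<omega> = z j) \<and> Z (k + 1) \<omega> = z') =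
    pmf (companion_step (z k)) z' * \<P>(\<omega> in P. \<forall>j\<in>{l..k}. Z j \<omega> = z j)"
  using l k
proof (induction l arbitrary: z rule: int_ge_induct)
  case base
  from cp interpret prob_space P by (simp add: companion_process_def)
  have meas [measurable]: "Z j \<in> P \<rightarrow>\<^sub>M count_space UNIV" if "k\<^sub>0 \<le> j" for j
    using cp that by (simp add: companion_process_def)
  let ?A = "{\<omega> \<in> space P. \<forall>j\<in>{k\<^sub>0..k}. Z j \<omega> = z j}"
  let ?B = "{\<omega> \<in> space P. (\<forall>j\<in>{k\<^sub>0..k}. Z j \<omega> = z j) \<and> Z (k + 1) \<omega> = z'}"
  have A: "?A \<in> sets P"
    by (intro sets.sets_Collect_finite_All) auto
  show ?case
  proof (cases "prob ?A > 0")
    case True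
    then have "\<P>(\<omega> in P. Z (k + 1) \<omega> = z' \<bar> \<forall>j\<in>{k\<^sub>0..k}. Z j \<omega> = z j) = pmf (companion_step (z k)) z'"
      using cp base unfolding companion_process_def by blast
    then show ?thesis using True
      unfolding cond_prob_def by (simp add: field_simps conj_commute)
  next
    case False
    then have 0: "prob ?A = 0" using measure_nonneg[of P ?A] by linarith
    have "prob ?B \<le> prob ?A" by (rule finite_measure_mono[OF _ A]) auto
    then have "prob ?B = 0" using 0 measure_nonneg[of P ?B] by linarith
    then show ?thesis using 0 by simp
  qed
next
  case (step l)
  from cp interpret prob_space P by (simp add: companion_process_def)
  have meas [measurable]: "Z j \<in> P \<rightarrow>\<^sub>M count_space UNIV" if "k\<^sub>0 \<le> j" for j
    using cp that by (simp add: companion_process_def)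
  have "l \<ge> k\<^sub>0" "l < k" using step by auto
  have fin: "{\<omega> \<in> space P. \<forall>j\<in>{l + 1..k}. Z j \<omega> = z j} \<in> sets P"
    using step by (intro sets.sets_Collect_finite_All) auto
  have Ml: "Z l \<in> P \<rightarrow>\<^sub>M count_space UNIV" and Mk: "Z (k + 1) \<in> P \<rightarrow>\<^sub>M count_space UNIV"
    using step by auto
  have split: "{l..k} = insert l {l + 1..k}" using \<open>l < k\<close> by auto
  show ?case
  proof (rule measure_proportional_on_fibres[OF Ml])
    show "{\<omega> \<in> space P. (\<forall>j\<in>{l + 1..k}. Z j \<omega> = z j) \<and> Z (k + 1) \<omega> = z'} \<in> sets P"
      using fin Mk by (intro sets.sets_Collect_conj) auto
  next
    fix x
    let ?z = "z(l := x)"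
    have 1: "{\<omega> \<in> space P. (\<forall>j\<in>{l + 1..k}. Z j \<omega> = z j) \<and> Z (k + 1) \<omega> = z'} \<inter> {\<omega> \<in> space P. Z l \<omega> = x} =
      {\<omega> \<in> space P. (\<forall>j\<in>{l..k}. Z j \<omega> = ?z j) \<and> Z (k + 1) \<omega> = z'}"
      unfolding split by auto
    have 2: "{\<omega> \<in> space P. (\<forall>j\<in>{l + 1..k}. Z j \<omega> = z j)} \<inter> {\<omega> \<in> space P. Z l \<omega> = x} =
      {\<omega> \<in> space P. (\<forall>j\<in>{l..k}. Z j \<omega> = ?z j)}"
      unfolding split by auto
    show "prob ({\<omega> \<in> space P. (\<forall>j\<in>{l + 1..k}. Z j \<omega> = z j) \<and> Z (k + 1) \<omega> = z'} \<inter> {\<omega> \<in> space P. Z l \<omega> = x}) =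
      pmf (companion_step (z k)) z' *
      prob ({\<omega> \<in> space P. (\<forall>j\<in>{l + 1..k}. Z j \<omega> = z j)} \<inter> {\<omega> \<in> space P. Z l \<omega> = x})"
      unfolding 1 2 using step.IH[of ?z] \<open>l < k\<close> by simp
  qed (rule fin)
qed

lemma companion_path:
  assumes cp: "companion_process P k\<^sub>0 Z" and l: "k\<^sub>0 \<le> l" and k: "l \<le> k"
  shows "\<P>(\<omega> in P. \<forall>j\<in>{l..k}. Z j \<omega> = z j) =
    \<P>(\<omega> in P. Z l \<omega> = z l) * (\<Prod>j\<in>{l..<k}. pmf (companion_step (z j)) (z (j + 1)))"
  using k
proof (induction k rule: int_ge_induct)
  case base
  then show ?case by simp
next
  case (step k)
  have 1: "{l..k + 1} = insert (k + 1) {l..k}" "{l..<k + 1} = insert k {l..<k}" using step by auto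
  have "\<P>(\<omega> in P. \<forall>j\<in>{l..k + 1}. Z j \<omega> = z j) =
    \<P>(\<omega> in P. (\<forall>j\<in>{l..k}. Z j \<omega> = z j) \<and> Z (k + 1) \<omega> = z (k + 1))"
    unfolding 1 by (intro arg_cong[where f = "measure P"]) auto
  then show ?case
    using companion_markov[OF cp l, of k z "z (k + 1)"] step by (simp add: 1)
qed

section \<open>Bridge laws\<close>

lemma sets_PiM_count_space:
  assumes "finite A"
  shows "PiM A (\<lambda>_. count_space UNIV :: 'b :: countable measure) = count_space (PiE A (\<lambda>_. UNIV))"
  using assms by (intro count_space_PiM_finite) auto

lemma
  fixes X :: "int \<Rightarrow> 'w \<Rightarrow> 'z :: countable"
  assumes Q: "prob_space Q" and meas: "\<And>j. j \<in> {k\<^sub>1..k\<^sub>2} \<Longrightarrow> X j \<in> Q \<rightarrow>\<^sub>M count_space UNIV"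
    and k: "k\<^sub>1 \<le> k\<^sub>2" and pos: "\<P>(\<omega> in Q. X k\<^sub>1 \<omega> = z\<^sub>1 \<and> X k\<^sub>2 \<omega> = z\<^sub>2) > 0"
  shows prob_space_bridge_law: "prob_space (bridge_law Q X k\<^sub>1 k\<^sub>2 z\<^sub>1 z\<^sub>2)"
    and emeasure_bridge_law: "z \<in> PiE {k\<^sub>1..k\<^sub>2} (\<lambda>_. UNIV) \<Longrightarrow>
      emeasure (bridge_law Q X k\<^sub>1 k\<^sub>2 z\<^sub>1 z\<^sub>2) {z} =
        (if z k\<^sub>1 = z\<^sub>1 \<and> z k\<^sub>2 = z\<^sub>2
         then ennreal (\<P>(\<omega> in Q. \<forall>j\<in>{k\<^sub>1..k\<^sub>2}. X j \<omega> = z j) / \<P>(\<omega> in Q. X k\<^sub>1 \<omega> = z\<^sub>1 \<and> X k\<^sub>2 \<omega> = z\<^sub>2))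
         else 0)"
proof -
  interpret prob_space Q by (rule Q)
  let ?E = "{\<omega> \<in> space Q. X k\<^sub>1 \<omega> = z\<^sub>1 \<and> X k\<^sub>2 \<omega> = z\<^sub>2}"
  let ?f = "\<lambda>\<omega>. \<lambda>j\<in>{k\<^sub>1..k\<^sub>2}. X j \<omega>"
  have [measurable]: "X k\<^sub>1 \<in> Q \<rightarrow>\<^sub>M count_space UNIV" "X k\<^sub>2 \<in> Q \<rightarrow>\<^sub>M count_space UNIV"
    using k by (auto intro: meas)
  have E: "?E \<in> sets Q" by measurable
  have f: "?f \<in> Q \<rightarrow>\<^sub>M (\<Pi>\<^sub>M j\<in>{k\<^sub>1..k\<^sub>2}. count_space UNIV)"
    by (intro measurable_restrict meas)
  have f': "?f \<in> uniform_measure Q ?E \<rightarrow>\<^sub>M (\<Pi>\<^sub>M j\<in>{k\<^sub>1..k\<^sub>2}. count_space UNIV)"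
    using f by simp
  have "prob_space (uniform_measure Q ?E)"
    using pos by (intro prob_space_uniform_measure) (auto simp: emeasure_eq_measure)
  then show "prob_space (bridge_law Q X k\<^sub>1 k\<^sub>2 z\<^sub>1 z\<^sub>2)"
    unfolding bridge_law_def by (rule prob_space.prob_space_distr[OF _ f'])
  assume z: "z \<in> PiE {k\<^sub>1..k\<^sub>2} (\<lambda>_. UNIV)"
  have path: "{\<omega> \<in> space Q. \<forall>j\<in>{k\<^sub>1..k\<^sub>2}. X j \<omega> = z j} \<in> sets Q"
    using meas by (intro sets.sets_Collect_finite_All) auto
  have pre: "?f -` {z} \<inter> space Q = {\<omega> \<in> space Q. \<forall>j\<in>{k\<^sub>1..k\<^sub>2}. X j \<omega> = z j}"
    using z by (auto simp: fun_eq_iff PiE_iff extensional_def)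
  have "emeasure (bridge_law Q X k\<^sub>1 k\<^sub>2 z\<^sub>1 z\<^sub>2) {z} =
    emeasure (uniform_measure Q ?E) {\<omega> \<in> space Q. \<forall>j\<in>{k\<^sub>1..k\<^sub>2}. X j \<omega> = z j}"
    unfolding bridge_law_def using z
    by (subst emeasure_distr[OF f']) (simp_all add: sets_PiM_count_space pre)
  also have "\<dots> = emeasure Q (?E \<inter> {\<omega> \<in> space Q. \<forall>j\<in>{k\<^sub>1..k\<^sub>2}. X j \<omega> = z j}) / emeasure Q ?E"
    by (rule emeasure_uniform_measure[OF E path])
  also have "?E \<inter> {\<omega> \<in> space Q. \<forall>j\<in>{k\<^sub>1..k\<^sub>2}. X j \<omega> = z j} =
    (if z k\<^sub>1 = z\<^sub>1 \<and> z k\<^sub>2 = z\<^sub>2 then {\<omega> \<in> space Q. \<forall>j\<in>{k\<^sub>1..k\<^sub>2}. X j \<omega> = z j} else {})"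
    using k by force
  finally show "emeasure (bridge_law Q X k\<^sub>1 k\<^sub>2 z\<^sub>1 z\<^sub>2) {z} =
        (if z k\<^sub>1 = z\<^sub>1 \<and> z k\<^sub>2 = z\<^sub>2
         then ennreal (\<P>(\<omega> in Q. \<forall>j\<in>{k\<^sub>1..k\<^sub>2}. X j \<omega> = z j) / \<P>(\<omega> in Q. X k\<^sub>1 \<omega> = z\<^sub>1 \<and> X k\<^sub>2 \<omega> = z\<^sub>2))
         else 0)"
    using pos by (simp add: emeasure_eq_measure divide_ennreal)
qed

text \<open>
  Bridge laws are probability measures on a countable space, so they agree as soon as the
  probabilities of the paths are proportional.
\<close>
lemma bridge_law_eqI:
  fixes X :: "int \<Rightarrow> 'v \<Rightarrow> 'z :: countable" and Y :: "int \<Rightarrow> 'w \<Rightarrow> 'z"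
  assumes Q: "prob_space Q" "\<And>j. j \<in> {k\<^sub>1..k\<^sub>2} \<Longrightarrow> X j \<in> Q \<rightarrow>\<^sub>M count_space UNIV"
      "\<P>(\<omega> in Q. X k\<^sub>1 \<omega> = z\<^sub>1 \<and> X k\<^sub>2 \<omega> = z\<^sub>2) > 0"
    and P: "prob_space P" "\<And>j. j \<in> {k\<^sub>1..k\<^sub>2} \<Longrightarrow> Y j \<in> P \<rightarrow>\<^sub>M count_space UNIV"
      "\<P>(\<omega> in P. Y k\<^sub>1 \<omega> = z\<^sub>1 \<and> Y k\<^sub>2 \<omega> = z\<^sub>2) > 0"
    and k: "k\<^sub>1 \<le> k\<^sub>2" and c: "c \<ge> 0"
    and ratio: "\<And>z. z k\<^sub>1 = z\<^sub>1 \<Longrightarrow> z k\<^sub>2 = z\<^sub>2 \<Longrightarrow>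
      \<P>(\<omega> in Q. \<forall>j\<in>{k\<^sub>1..k\<^sub>2}. X j \<omega> = z j) = c * \<P>(\<omega> in P. \<forall>j\<in>{k\<^sub>1..k\<^sub>2}. Y j \<omega> = z j)"
  shows "bridge_law Q X k\<^sub>1 k\<^sub>2 z\<^sub>1 z\<^sub>2 = bridge_law P Y k\<^sub>1 k\<^sub>2 z\<^sub>1 z\<^sub>2"
proof -
  let ?A = "bridge_law Q X k\<^sub>1 k\<^sub>2 z\<^sub>1 z\<^sub>2" and ?B = "bridge_law P Y k\<^sub>1 k\<^sub>2 z\<^sub>1 z\<^sub>2"
  let ?\<Omega> = "PiE {k\<^sub>1..k\<^sub>2} (\<lambda>_. UNIV :: 'z set)"
  let ?q = "\<P>(\<omega> in Q. X k\<^sub>1 \<omega> = z\<^sub>1 \<and> X k\<^sub>2 \<omega> = z\<^sub>2)"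
  let ?p = "\<P>(\<omega> in P. Y k\<^sub>1 \<omega> = z\<^sub>1 \<and> Y k\<^sub>2 \<omega> = z\<^sub>2)"
  define d where "d = c * ?p / ?q"
  have d: "d \<ge> 0" using c Q(3) P(3) by (simp add: d_def)
  have sets: "sets ?A = Pow ?\<Omega>" "sets ?B = Pow ?\<Omega>" "space ?A = ?\<Omega>" "space ?B = ?\<Omega>"
    by (simp_all add: bridge_law_def sets_PiM_count_space)
  have AB: "?A = scale_measure (ennreal d) ?B"
  proof (rule measure_eqI_countable)
    show "countable ?\<Omega>" by (intro countable_PiE) auto
    fix z assume z: "z \<in> ?\<Omega>"
    note em = emeasure_bridge_law[OF Q(1) Q(2) k Q(3) z] emeasure_bridge_law[OF P(1) P(2) k P(3) z]
    show "emeasure ?A {z} = emeasure (scale_measure (ennreal d) ?B) {z}"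
    proof (cases "z k\<^sub>1 = z\<^sub>1 \<and> z k\<^sub>2 = z\<^sub>2")
      case True
      let ?w = "\<P>(\<omega> in P. \<forall>j\<in>{k\<^sub>1..k\<^sub>2}. Y j \<omega> = z j)"
      have "c * ?w / ?q = d * (?w / ?p)" using P(3) Q(3) by (simp add: d_def)
      then have "ennreal (c * ?w / ?q) = ennreal (d * (?w / ?p))" by (rule arg_cong)
      also have "\<dots> = ennreal d * ennreal (?w / ?p)"
        using d by (intro ennreal_mult) auto
      finally have "ennreal (c * ?w / ?q) = ennreal d * ennreal (?w / ?p)" .
      moreover have "emeasure ?A {z} = ennreal (c * ?w / ?q)" "emeasure ?B {z} = ennreal (?w / ?p)"
        using True em ratio[of z] by simp_all
      ultimately show ?thesis by simp
    next
      case False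
      then have "emeasure ?A {z} = 0" "emeasure ?B {z} = 0" using em by auto
      then show ?thesis by simp
    qed
  qed (use sets in simp_all)
  have "emeasure ?A ?\<Omega> = 1" "emeasure ?B ?\<Omega> = 1"
    using prob_space.emeasure_space_1[OF prob_space_bridge_law[OF Q(1,2) k Q(3)]]
      prob_space.emeasure_space_1[OF prob_space_bridge_law[OF P(1,2) k P(3)]] sets by simp_all
  moreover have "emeasure ?A ?\<Omega> = ennreal d * emeasure ?B ?\<Omega>"
    by (subst AB) simp
  ultimately have "ennreal d = 1" by simp
  then show ?thesis using AB by simp
qed

section \<open>Paths of the process of a tree\<close>

lemma count_abscissae:
  "count (abscissae i T) j = card {v \<in> vertices T. i + abscissa v = j}"
proof (induction T arbitrary: i)
  case (Node l x r)
  let ?V = "\<lambda>i T. {v \<in> vertices T. i + abscissa v = j}"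
  have eq: "?V i (Node l x r) = (if i = j then {[]} else {}) \<union>
    (Cons L ` ?V (i - 1) l \<union> Cons R ` ?V (i + 1) r)"
    by (auto simp: abscissa_def algebra_simps)
  have fin: "finite (?V i T)" for i and T :: "'a tree" by (simp add: finite_vertices)
  have "card (Cons L ` ?V (i - 1) l \<union> Cons R ` ?V (i + 1) r) =
    count (abscissae (i - 1) l) j + count (abscissae (i + 1) r) j"
    unfolding Node.IH by (subst card_Un_disjoint) (auto simp: finite_vertices card_image)
  then show ?case unfolding eq by (auto simp: card_insert_if finite_vertices)
qed simp

lemma tree_M_eq: "tree_M T j = int (count (abscissae 0 T) j)"
  by (simp add: tree_M_def count_abscissae)

lemma tree_S_eq: "tree_S T i = int (size (filter_mset (\<lambda>x. x \<le> i) (abscissae 0 T)))"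
proof -
  have "{j. j \<le> i \<and> tree_M T j \<noteq> 0} = set_mset (filter_mset (\<lambda>x. x \<le> i) (abscissae 0 T))"
    by (auto simp: tree_M_eq)
  then show ?thesis
    by (simp add: tree_S_def tree_M_eq size_multiset_overloaded_eq)
qed

text \<open>
  The process of a tree, as a function of the multiset of the abscissae of its vertices.
\<close>
definition profile_Z :: "int multiset \<Rightarrow> int \<Rightarrow> int \<times> int \<times> int" where
  "profile_Z \<mu> i = (int (count \<mu> i) - int (count \<mu> (i - 1)), int (count \<mu> i),
     int (size (filter_mset (\<lambda>x. x \<le> i) \<mu>)))"

lemma tree_Z_eq: "tree_Z T i = profile_Z (abscissae 0 T) i"
  by (simp add: tree_Z_def profile_Z_def tree_Delta_def tree_M_eq tree_S_eq)

lemma card_trees_abscissae: "card {T :: unit tree. abscissae 0 T = \<mu>} = fcount [0] \<mu>"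
proof -
  have "forests [0] \<mu> = (\<lambda>T. [T]) ` {T. abscissae 0 T = \<mu>}"
    by (auto simp: forests_def length_Suc_conv)
  then show ?thesis by (simp add: fcount_def card_image inj_on_def)
qed

lemma size_filter_mset_le_Suc:
  "size (filter_mset (\<lambda>x. x \<le> j + 1) \<mu>) = size (filter_mset (\<lambda>x. x \<le> j) \<mu>) + count \<mu> (j + 1 :: int)"
proof -
  have "filter_mset (\<lambda>x. x \<le> j + 1) \<mu> = filter_mset (\<lambda>x. x \<le> j) \<mu> + replicate_mset (count \<mu> (j + 1)) (j + 1)"
    by (auto simp: multiset_eq_iff)
  then show ?thesis by simp
qed

text \<open>The second component of a state, the number of vertices.\<close>
abbreviation M_of :: "int \<times> int \<times> int \<Rightarrow> int" where "M_of z \<equiv> fst (snd z)"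

text \<open>
  If \<open>M\<close> is positive at the end points, both processes follow only paths along which \<open>M\<close> stays positive, \<open>\<Delta>\<close> is the increment of \<open>M\<close> and
  \<open>M\<close> is the increment of \<open>S\<close>. For \<open>\<Delta>\<close> and \<open>S\<close> nothing is required at \<open>k\<^sub>1\<close>.
\<close>
definition admissible :: "int \<Rightarrow> int \<Rightarrow> (int \<Rightarrow> int \<times> int \<times> int) \<Rightarrow> bool" where
  "admissible k\<^sub>1 k\<^sub>2 z \<longleftrightarrow> (\<forall>j\<in>{k\<^sub>1..k\<^sub>2}. 0 < M_of (z j)) \<and>
     (\<forall>j\<in>{k\<^sub>1..<k\<^sub>2}. z (j + 1) =
        (M_of (z (j + 1)) - M_of (z j), M_of (z (j + 1)), snd (snd (z j)) + M_of (z (j + 1))))"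

text \<open>
  The product of binomial coefficients of an admissible path. Here \<open>M - \<Delta>\<close> stands for the preceding
  value of \<open>M\<close>, which for the first factor lies outside the path.
\<close>
definition path_weight :: "int \<Rightarrow> int \<Rightarrow> (int \<Rightarrow> int \<times> int \<times> int) \<Rightarrow> real" where
  "path_weight k\<^sub>1 k\<^sub>2 z = (\<Prod>j\<in>{k\<^sub>1..<k\<^sub>2}.
     real ((nat (M_of (z j) - fst (z j)) + nat (M_of (z (j + 1))) - 1) choose (nat (M_of (z j)) - 1)))"

lemma tree_path_admissible:
  assumes k: "0 < k\<^sub>1 \<and> k\<^sub>1 < k\<^sub>2 \<or> k\<^sub>1 < k\<^sub>2 \<and> k\<^sub>2 < 0"
    and path: "\<And>j. j \<in> {k\<^sub>1..k\<^sub>2} \<Longrightarrow> tree_Z T j = z j"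
    and pos: "0 < M_of (z k\<^sub>1)" "0 < M_of (z k\<^sub>2)"
  shows "admissible k\<^sub>1 k\<^sub>2 z"
  unfolding admissible_def
proof (intro conjI ballI)
  let ?\<mu> = "abscissae 0 T"
  have M: "M_of (z j) = int (count ?\<mu> j)" if "j \<in> {k\<^sub>1..k\<^sub>2}" for j
    using path[OF that, symmetric] by (simp add: tree_Z_eq profile_Z_def)
  have in1: "k\<^sub>1 \<in># ?\<mu>" and in2: "k\<^sub>2 \<in># ?\<mu>" using pos M[of k\<^sub>1] M[of k\<^sub>2] k by auto
  fix j assume j: "j \<in> {k\<^sub>1..k\<^sub>2}"
  show "0 < M_of (z j)"
  proof (rule ccontr)
    assume "\<not> 0 < M_of (z j)"
    then have n: "j \<notin># ?\<mu>" using M[OF j] by (simp add: not_in_iff)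
    from k show False
    proof
      assume "0 < k\<^sub>1 \<and> k\<^sub>1 < k\<^sub>2"
      then show False using abscissae_less[OF _ n in2] j by auto
    next
      assume "k\<^sub>1 < k\<^sub>2 \<and> k\<^sub>2 < 0"
      then show False using abscissae_greater[OF _ n in1] j by auto
    qed
  qed
next
  fix j assume j: "j \<in> {k\<^sub>1..<k\<^sub>2}"
  then have "j \<in> {k\<^sub>1..k\<^sub>2}" "j + 1 \<in> {k\<^sub>1..k\<^sub>2}" by auto
  from path[OF this(1), symmetric] path[OF this(2), symmetric]
  show "z (j + 1) = (M_of (z (j + 1)) - M_of (z j), M_of (z (j + 1)), snd (snd (z j)) + M_of (z (j + 1)))"
    by (simp add: tree_Z_eq profile_Z_def size_filter_mset_le_Suc)
qed

text \<open>
  The vertices that are prescribed by a path but not already by its end points: since \<open>z k\<^sub>2\<close>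
  determines the number of vertices at \<open>k\<^sub>2 - 1\<close>, these are the ones strictly between \<open>k\<^sub>1\<close> and
  \<open>k\<^sub>2 - 1\<close>.
\<close>
definition path_middle :: "int \<Rightarrow> int \<Rightarrow> (int \<Rightarrow> int \<times> int \<times> int) \<Rightarrow> int multiset" where
  "path_middle k\<^sub>1 k\<^sub>2 z = (\<Sum>j\<in>{k\<^sub>1<..<k\<^sub>2 - 1}. replicate_mset (nat (M_of (z j))) j)"

lemma count_path_middle:
  "count (path_middle k\<^sub>1 k\<^sub>2 z) x = (if x \<in> {k\<^sub>1<..<k\<^sub>2 - 1} then nat (M_of (z x)) else 0)"
proof -
  have "count (path_middle k\<^sub>1 k\<^sub>2 z) x = (\<Sum>j\<in>{k\<^sub>1<..<k\<^sub>2 - 1}. if x = j then nat (M_of (z j)) else 0)"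
    unfolding path_middle_def count_sum by (intro sum.cong refl) simp
  then show ?thesis by simp
qed

text \<open>
  Replacing the vertices strictly between \<open>k\<^sub>1\<close> and \<open>k\<^sub>2 - 1\<close> by those of an admissible path with the
  same end points preserves the total number of vertices, because \<open>S\<close> at \<open>k\<^sub>2\<close> is unchanged.
\<close>
lemma profile_Z_refill:
  assumes k: "k\<^sub>1 < k\<^sub>2" and adm: "admissible k\<^sub>1 k\<^sub>2 z"
    and e1: "profile_Z \<mu>' k\<^sub>1 = z k\<^sub>1" and e2: "profile_Z \<mu>' k\<^sub>2 = z k\<^sub>2"
  defines "\<mu> \<equiv> filter_mset (\<lambda>x. x \<le> k\<^sub>1 \<or> k\<^sub>2 - 1 \<le> x) \<mu>' + path_middle k\<^sub>1 k\<^sub>2 z"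
  shows "size \<mu> = size \<mu>'" and "\<And>j. j \<in> {k\<^sub>1..k\<^sub>2} \<Longrightarrow> profile_Z \<mu> j = z j"
proof -
  have step: "z (j + 1) = (M_of (z (j + 1)) - M_of (z j), M_of (z (j + 1)), snd (snd (z j)) + M_of (z (j + 1)))"
    if "j \<in> {k\<^sub>1..<k\<^sub>2}" for j using adm that unfolding admissible_def by blast
  have cnt: "count \<mu> x = (if x \<in> {k\<^sub>1<..<k\<^sub>2 - 1} then nat (M_of (z x)) else count \<mu>' x)" for x
    by (auto simp: \<mu>_def count_path_middle)
  have pos: "0 < M_of (z j)" if "j \<in> {k\<^sub>1..k\<^sub>2}" for j using adm that unfolding admissible_def by blast
  have "int (count \<mu>' (k\<^sub>2 - 1)) = M_of (z (k\<^sub>2 - 1))"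
    using step[of "k\<^sub>2 - 1"] k e2[symmetric] by (simp add: profile_Z_def)
  moreover have "int (count \<mu>' k\<^sub>1) = M_of (z k\<^sub>1)" "int (count \<mu>' k\<^sub>2) = M_of (z k\<^sub>2)"
    using e1[symmetric] e2[symmetric] by (simp_all add: profile_Z_def)
  ultimately have M: "int (count \<mu> j) = M_of (z j)" if j: "j \<in> {k\<^sub>1..k\<^sub>2}" for j
  proof (cases "j \<in> {k\<^sub>1<..<k\<^sub>2 - 1}")
    case True
    then show ?thesis using pos[OF j] by (simp add: cnt)
  next
    case False
    then have "j = k\<^sub>1 \<or> j = k\<^sub>2 - 1 \<or> j = k\<^sub>2" using j by auto
    then show ?thesis
      using False \<open>int (count \<mu>' (k\<^sub>2 - 1)) = M_of (z (k\<^sub>2 - 1))\<close> \<open>int (count \<mu>' k\<^sub>1) = M_of (z k\<^sub>1)\<close>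
        \<open>int (count \<mu>' k\<^sub>2) = M_of (z k\<^sub>2)\<close> by (auto simp: cnt)
  qed
  show Z: "profile_Z \<mu> j = z j" if "j \<in> {k\<^sub>1..k\<^sub>2}" for j
  proof -
    from that have "k\<^sub>1 \<le> j" by simp
    then have "j \<le> k\<^sub>2 \<Longrightarrow> profile_Z \<mu> j = z j"
    proof (induction j rule: int_ge_induct)
      case base
      have "filter_mset (\<lambda>x. x \<le> k\<^sub>1) \<mu> = filter_mset (\<lambda>x. x \<le> k\<^sub>1) \<mu>'"
        by (auto simp: multiset_eq_iff cnt)
      moreover have "count \<mu> k\<^sub>1 = count \<mu>' k\<^sub>1" "count \<mu> (k\<^sub>1 - 1) = count \<mu>' (k\<^sub>1 - 1)"
        by (simp_all add: cnt)
      ultimately show ?case using e1 by (simp add: profile_Z_def)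
    next
      case (step j)
      then have "profile_Z \<mu> j = z j" by simp
      from this[symmetric] have "snd (snd (z j)) = int (size (filter_mset (\<lambda>x. x \<le> j) \<mu>))"
        by (simp add: profile_Z_def)
      moreover have "int (count \<mu> (j + 1)) = M_of (z (j + 1))" "int (count \<mu> j) = M_of (z j)"
        using M[of "j + 1"] M[of j] step by auto
      moreover have "z (j + 1) = (M_of (z (j + 1)) - M_of (z j), M_of (z (j + 1)), snd (snd (z j)) + M_of (z (j + 1)))"
        using adm step unfolding admissible_def by simp
      ultimately show ?case
        by (simp add: profile_Z_def size_filter_mset_le_Suc)
    qed
    then show ?thesis using that by simp
  qed
  have "size (filter_mset (\<lambda>x. x \<le> k\<^sub>2) \<mu>) = size (filter_mset (\<lambda>x. x \<le> k\<^sub>2) \<mu>')"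
    using trans[OF Z e2[symmetric]] k by (simp add: profile_Z_def)
  moreover have "filter_mset (\<lambda>x. \<not> x \<le> k\<^sub>2) \<mu> = filter_mset (\<lambda>x. \<not> x \<le> k\<^sub>2) \<mu>'"
    by (auto simp: multiset_eq_iff cnt)
  ultimately show "size \<mu> = size \<mu>'"
    using multiset_partition[of \<mu> "\<lambda>x. x \<le> k\<^sub>2"] multiset_partition[of \<mu>' "\<lambda>x. x \<le> k\<^sub>2"]
    by (metis size_union)
qed

text \<open>
  The constant \<open>C\<close> depends on the end points only: the possible configurations \<open>\<rho>\<close> of the vertices
  outside the open interval from \<open>k\<^sub>1\<close> to \<open>k\<^sub>2 - 1\<close> are the same for all admissible paths.
\<close>
lemma card_tree_paths:
  assumes k: "0 < k\<^sub>1 \<and> k\<^sub>1 < k\<^sub>2 \<or> k\<^sub>1 < k\<^sub>2 \<and> k\<^sub>2 < 0"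
  shows "\<exists>C. C \<ge> 0 \<and> (\<forall>z. z k\<^sub>1 = z\<^sub>1 \<longrightarrow> z k\<^sub>2 = z\<^sub>2 \<longrightarrow> admissible k\<^sub>1 k\<^sub>2 z \<longrightarrow>
    real (card {T :: unit tree. size T = n \<and> (\<forall>j\<in>{k\<^sub>1..k\<^sub>2}. tree_Z T j = z j)}) = C * path_weight k\<^sub>1 k\<^sub>2 z)"
proof -
  have k12: "k\<^sub>1 < k\<^sub>2" using k by auto
  let ?P = "\<lambda>x. x \<le> k\<^sub>1 \<or> k\<^sub>2 - 1 \<le> x"
  obtain F where F: "(\<forall>j\<in>{k\<^sub>1..k\<^sub>2}. 0 < count \<mu> j) \<Longrightarrow>
    real (fcount [0] \<mu>) = F (filter_mset ?P \<mu>) *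
      (\<Prod>j\<in>{k\<^sub>1..<k\<^sub>2}. real ((count \<mu> (j - 1) + count \<mu> (j + 1) - 1) choose (count \<mu> j - 1)))" for \<mu>
    using fcount_root_profile[OF k] by blast
  define E where "E = {T :: unit tree. size T = n \<and> tree_Z T k\<^sub>1 = z\<^sub>1 \<and> tree_Z T k\<^sub>2 = z\<^sub>2}"
  define R where "R = (\<lambda>T. filter_mset ?P (abscissae 0 T)) ` E"
  have "finite E"
    by (rule finite_subset[OF _ finite_trees[of n]]) (auto simp: E_def)
  then have fR: "finite R" by (simp add: R_def)
  have main: "real (card {T :: unit tree. size T = n \<and> (\<forall>j\<in>{k\<^sub>1..k\<^sub>2}. tree_Z T j = z j)}) =
    (\<Sum>\<rho>\<in>R. F \<rho>) * path_weight k\<^sub>1 k\<^sub>2 z"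
    if z: "z k\<^sub>1 = z\<^sub>1" "z k\<^sub>2 = z\<^sub>2" and adm: "admissible k\<^sub>1 k\<^sub>2 z" for z
  proof -
    let ?m = "path_middle k\<^sub>1 k\<^sub>2 z"
    let ?W = "\<lambda>\<rho>. {T :: unit tree. abscissae 0 T = \<rho> + ?m}"
    have pos: "0 < M_of (z j)" if "j \<in> {k\<^sub>1..k\<^sub>2}" for j
      using adm that unfolding admissible_def by blast
    have refill: "size (\<rho> + ?m) = n \<and> (\<forall>j\<in>{k\<^sub>1..k\<^sub>2}. profile_Z (\<rho> + ?m) j = z j) \<and>
        filter_mset ?P (\<rho> + ?m) = \<rho>" if "\<rho> \<in> R" for \<rho>
    proof -
      from that obtain T where T: "T \<in> E" "\<rho> = filter_mset ?P (abscissae 0 T)"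
        by (auto simp: R_def)
      then have "profile_Z (abscissae 0 T) k\<^sub>1 = z k\<^sub>1" "profile_Z (abscissae 0 T) k\<^sub>2 = z k\<^sub>2" "size T = n"
        using z by (auto simp: E_def tree_Z_eq)
      from profile_Z_refill[OF k12 adm this(1,2)] this(3)
      have "size (\<rho> + ?m) = n \<and> (\<forall>j\<in>{k\<^sub>1..k\<^sub>2}. profile_Z (\<rho> + ?m) j = z j)"
        unfolding T(2) by simp
      moreover have "filter_mset ?P (\<rho> + ?m) = \<rho>"
        unfolding T(2) by (auto simp: multiset_eq_iff count_path_middle)
      ultimately show ?thesis by blast
    qed
    have "{T :: unit tree. size T = n \<and> (\<forall>j\<in>{k\<^sub>1..k\<^sub>2}. tree_Z T j = z j)} = (\<Union>\<rho>\<in>R. ?W \<rho>)"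
    proof (intro Set.equalityI subsetI)
      fix T :: "unit tree"
      assume "T \<in> {T. size T = n \<and> (\<forall>j\<in>{k\<^sub>1..k\<^sub>2}. tree_Z T j = z j)}"
      then have T: "size T = n" "\<And>j. j \<in> {k\<^sub>1..k\<^sub>2} \<Longrightarrow> tree_Z T j = z j" by auto
      let ?\<rho> = "filter_mset ?P (abscissae 0 T)"
      have "T \<in> E" using T(1) T(2)[of k\<^sub>1] T(2)[of k\<^sub>2] k12 z by (simp add: E_def)
      then have "?\<rho> \<in> R" by (simp add: R_def)
      moreover have "abscissae 0 T = ?\<rho> + ?m"
      proof (rule multiset_eqI)
        fix x
        show "count (abscissae 0 T) x = count (?\<rho> + ?m) x"
        proof (cases "x \<in> {k\<^sub>1<..<k\<^sub>2 - 1}")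
          case True
          then have "M_of (z x) = int (count (abscissae 0 T) x)"
            using T(2)[of x, symmetric] by (simp add: tree_Z_eq profile_Z_def)
          then show ?thesis using True by (simp add: count_path_middle)
        next
          case False
          then show ?thesis by (auto simp: count_path_middle)
        qed
      qed
      ultimately show "T \<in> (\<Union>\<rho>\<in>R. ?W \<rho>)" by blast
    next
      fix T assume "T \<in> (\<Union>\<rho>\<in>R. ?W \<rho>)"
      then obtain \<rho> where \<rho>: "\<rho> \<in> R" "abscissae 0 T = \<rho> + ?m" by auto
      have "size (abscissae 0 T) = n" "\<forall>j\<in>{k\<^sub>1..k\<^sub>2}. profile_Z (abscissae 0 T) j = z j"
        unfolding \<rho>(2) using refill[OF \<rho>(1)] by blast+
      then show "T \<in> {T. size T = n \<and> (\<forall>j\<in>{k\<^sub>1..k\<^sub>2}. tree_Z T j = z j)}"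
        by (simp add: tree_Z_eq)
    qed
    also have "card \<dots> = (\<Sum>\<rho>\<in>R. card (?W \<rho>))"
    proof (rule card_UN_disjoint[OF fR])
      show "\<forall>\<rho>\<in>R. finite (?W \<rho>)"
      proof
        fix \<rho>
        have "?W \<rho> \<subseteq> {T. size T \<le> size (\<rho> + ?m)}"
          by (metis (mono_tags, lifting) mem_Collect_eq order_refl size_abscissae subsetI)
        then show "finite (?W \<rho>)" using finite_trees finite_subset by blast
      qed
    qed auto
    also have "real \<dots> = (\<Sum>\<rho>\<in>R. F \<rho> * path_weight k\<^sub>1 k\<^sub>2 z)"
      unfolding of_nat_sum
    proof (intro sum.cong refl)
      fix \<rho> assume \<rho>: "\<rho> \<in> R"
      let ?\<mu> = "\<rho> + ?m"
      have Z: "profile_Z ?\<mu> j = z j" if "j \<in> {k\<^sub>1..k\<^sub>2}" for j using refill[OF \<rho>] that by blast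
      have cnt: "count ?\<mu> j = nat (M_of (z j))" "count ?\<mu> (j - 1) = nat (M_of (z j) - fst (z j))"
        if "j \<in> {k\<^sub>1..k\<^sub>2}" for j
        using Z[OF that, symmetric] by (simp_all add: profile_Z_def)
      have "\<forall>j\<in>{k\<^sub>1..k\<^sub>2}. 0 < count ?\<mu> j" using pos cnt(1) by simp
      then have "real (fcount [0] ?\<mu>) = F \<rho> *
        (\<Prod>j\<in>{k\<^sub>1..<k\<^sub>2}. real ((count ?\<mu> (j - 1) + count ?\<mu> (j + 1) - 1) choose (count ?\<mu> j - 1)))"
        using F[of ?\<mu>] refill[OF \<rho>] by simp
      also have "(\<Prod>j\<in>{k\<^sub>1..<k\<^sub>2}. real ((count ?\<mu> (j - 1) + count ?\<mu> (j + 1) - 1) choose (count ?\<mu> j - 1))) =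
        path_weight k\<^sub>1 k\<^sub>2 z"
        unfolding path_weight_def
      proof (intro prod.cong refl)
        fix j assume "j \<in> {k\<^sub>1..<k\<^sub>2}"
        then have j: "j \<in> {k\<^sub>1..k\<^sub>2}" "j + 1 \<in> {k\<^sub>1..k\<^sub>2}" by auto
        show "real ((count ?\<mu> (j - 1) + count ?\<mu> (j + 1) - 1) choose (count ?\<mu> j - 1)) =
          real ((nat (M_of (z j) - fst (z j)) + nat (M_of (z (j + 1))) - 1) choose (nat (M_of (z j)) - 1))"
          unfolding cnt(1)[OF j(1)] cnt(2)[OF j(1)] cnt(1)[OF j(2)] ..
      qed
      finally show "real (card (?W \<rho>)) = F \<rho> * path_weight k\<^sub>1 k\<^sub>2 z"
        by (simp only: card_trees_abscissae)
    qed
    also have "\<dots> = (\<Sum>\<rho>\<in>R. F \<rho>) * path_weight k\<^sub>1 k\<^sub>2 z"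
      by (simp add: sum_distrib_right)
    finally show ?thesis .
  qed
  \<comment> \<open>the absolute value makes the constant nonnegative even when there is no admissible path\<close>
  have "real (card {T :: unit tree. size T = n \<and> (\<forall>j\<in>{k\<^sub>1..k\<^sub>2}. tree_Z T j = z j)}) =
    \<bar>\<Sum>\<rho>\<in>R. F \<rho>\<bar> * path_weight k\<^sub>1 k\<^sub>2 z"
    if z: "z k\<^sub>1 = z\<^sub>1" "z k\<^sub>2 = z\<^sub>2" and adm: "admissible k\<^sub>1 k\<^sub>2 z" for z
  proof -
    have "path_weight k\<^sub>1 k\<^sub>2 z \<ge> 0" by (simp add: path_weight_def prod_nonneg)
    then show ?thesis using arg_cong[OF main[OF z adm], of abs] by (simp add: abs_mult)
  qed
  then show ?thesis by (intro exI[of _ "\<bar>\<Sum>\<rho>\<in>R. F \<rho>\<bar>"]) auto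
qed

section \<open>Comparison of the two processes\<close>

lemma companion_path_admissible:
  assumes nz: "(\<Prod>j\<in>{k\<^sub>1..<k\<^sub>2}. pmf (companion_step (z j)) (z (j + 1))) \<noteq> 0"
    and pos: "0 < M_of (z k\<^sub>2)"
  shows "admissible k\<^sub>1 k\<^sub>2 z"
proof -
  have path_step: "z (j + 1) \<in> set_pmf (companion_step (z j))" if "j \<in> {k\<^sub>1..<k\<^sub>2}" for j
    using nz that by (auto simp: set_pmf_iff)
  have P: "0 < M_of (z j)" if j: "j \<in> {k\<^sub>1..k\<^sub>2}" for j
  proof (rule ccontr)
    assume neg: "\<not> 0 < M_of (z j)"
    \<comment> \<open>the killed chain is constant from \<open>j\<close> on, which contradicts positivity at \<open>k\<^sub>2\<close>\<close>
    have "i \<le> k\<^sub>2 \<longrightarrow> \<not> 0 < M_of (z i)" if "j \<le> i" for i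
      using that
    proof (induction i rule: int_ge_induct)
      case (step i)
      show ?case
      proof
        assume "i + 1 \<le> k\<^sub>2"
        moreover from this have "M_of (z i) \<le> 0" using step by simp
        then have "set_pmf (companion_step (z i)) = {z i}"
          by (simp add: companion_step_def case_prod_unfold)
        ultimately have "z (i + 1) = z i" using path_step[of i] step j by auto
        then show "\<not> 0 < M_of (z (i + 1))" using \<open>M_of (z i) \<le> 0\<close> by simp
      qed
    qed (use neg in simp)
    from this[of k\<^sub>2] show False using pos j by simp
  qed
  have "z (j + 1) = (M_of (z (j + 1)) - M_of (z j), M_of (z (j + 1)), snd (snd (z j)) + M_of (z (j + 1)))"
    if j: "j \<in> {k\<^sub>1..<k\<^sub>2}" for j
  proof -
    obtain \<delta> m s where z: "z j = (\<delta>, m, s)" by (metis prod_cases3)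
    have "m > 0" using P[of j] j z by simp
    with path_step[OF j] show ?thesis unfolding z companion_step_pos[OF \<open>m > 0\<close>] by auto
  qed
  with P show ?thesis unfolding admissible_def by blast
qed

text \<open>
  Up to a power of two, the probability of an admissible path of the chain is the same product of
  binomial coefficients. The exponent, the sum of \<open>M (j - 1) + M (j + 1)\<close> over \<open>j\<close> from \<open>k\<^sub>1\<close> to \<open>k\<^sub>2 - 1\<close>,
  is determined by the end points.
\<close>
lemma companion_path_weight:
  assumes adm: "admissible k\<^sub>1 k\<^sub>2 z" and k: "k\<^sub>1 \<le> k\<^sub>2" and \<delta>: "fst (z k\<^sub>1) \<le> M_of (z k\<^sub>1)"
  shows "(\<Prod>j\<in>{k\<^sub>1..<k\<^sub>2}. pmf (companion_step (z j)) (z (j + 1))) = path_weight k\<^sub>1 k\<^sub>2 z /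
    2 ^ nat (2 * (snd (snd (z k\<^sub>2)) - snd (snd (z k\<^sub>1))) + (2 * M_of (z k\<^sub>1) - fst (z k\<^sub>1)) -
             (2 * M_of (z k\<^sub>2) - fst (z k\<^sub>2)))"
proof -
  let ?e = "\<lambda>q. 2 * (snd (snd (z q)) - snd (snd (z k\<^sub>1))) + (2 * M_of (z k\<^sub>1) - fst (z k\<^sub>1)) -
             (2 * M_of (z q) - fst (z q))"
  have pos: "0 < M_of (z j)" if "j \<in> {k\<^sub>1..k\<^sub>2}" for j
    using adm that unfolding admissible_def by blast
  have rec: "z (j + 1) = (M_of (z (j + 1)) - M_of (z j), M_of (z (j + 1)), snd (snd (z j)) + M_of (z (j + 1)))"
    if "j \<in> {k\<^sub>1..<k\<^sub>2}" for j using adm that unfolding admissible_def by blast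
  have "q \<le> k\<^sub>2 \<longrightarrow> 0 \<le> ?e q \<and> fst (z q) \<le> M_of (z q) \<and>
    (\<Prod>j\<in>{k\<^sub>1..<q}. pmf (companion_step (z j)) (z (j + 1))) = path_weight k\<^sub>1 q z / 2 ^ nat (?e q)"
    if "k\<^sub>1 \<le> q" for q
    using that
  proof (induction q rule: int_ge_induct)
    case base
    then show ?case using \<delta> by (simp add: path_weight_def)
  next
    case (step q)
    show ?case
    proof
      assume le: "q + 1 \<le> k\<^sub>2"
      then have q: "q \<in> {k\<^sub>1..<k\<^sub>2}" "q \<in> {k\<^sub>1..k\<^sub>2}" "q + 1 \<in> {k\<^sub>1..k\<^sub>2}" using step by auto
      obtain \<delta> m s where zq: "z q = (\<delta>, m, s)" by (metis prod_cases3)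
      define m' where "m' = M_of (z (q + 1))"
      have zq1: "z (q + 1) = (m' - m, m', s + m')" using rec[OF q(1)] by (simp add: zq m'_def)
      have m: "0 < m" "0 < m'" using pos[OF q(2)] pos[OF q(3)] by (simp_all add: zq m'_def)
      have IH: "0 \<le> ?e q" "\<delta> \<le> m"
        "(\<Prod>j\<in>{k\<^sub>1..<q}. pmf (companion_step (z j)) (z (j + 1))) = path_weight k\<^sub>1 q z / 2 ^ nat (?e q)"
        using step le by (auto simp: zq)
      have e: "?e (q + 1) = ?e q + ((m - \<delta>) + m')" by (simp add: zq zq1)
      then have e': "nat (?e (q + 1)) = nat (?e q) + (nat (m - \<delta>) + nat m')"
        using IH(1,2) m by linarith
      have split: "{k\<^sub>1..<q + 1} = insert q {k\<^sub>1..<q}" using step by auto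
      have "pmf (companion_step (z q)) (z (q + 1)) =
        real ((nat (m - \<delta>) + nat m' - 1) choose (nat m - 1)) / 2 ^ (nat (m - \<delta>) + nat m')"
        unfolding zq zq1 by (rule pmf_companion_step[OF m IH(2)])
      moreover have "path_weight k\<^sub>1 (q + 1) z =
        real ((nat (m - \<delta>) + nat m' - 1) choose (nat m - 1)) * path_weight k\<^sub>1 q z"
        unfolding path_weight_def split by (simp add: zq zq1)
      ultimately have "(\<Prod>j\<in>{k\<^sub>1..<q + 1}. pmf (companion_step (z j)) (z (j + 1))) =
         path_weight k\<^sub>1 (q + 1) z / 2 ^ nat (?e (q + 1))"
        unfolding split e' using IH(3) by (simp add: power_add)
      moreover have "0 \<le> ?e (q + 1)" using e IH(1,2) m by linarith
      ultimately show "0 \<le> ?e (q + 1) \<and> fst (z (q + 1)) \<le> M_of (z (q + 1)) \<and>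
        (\<Prod>j\<in>{k\<^sub>1..<q + 1}. pmf (companion_step (z j)) (z (j + 1))) =
         path_weight k\<^sub>1 (q + 1) z / 2 ^ nat (?e (q + 1))"
        using m by (simp add: zq1)
    qed
  qed
  then show ?thesis using k by blast
qed

theorem proposition5:
  fixes P :: "'w measure" and Z :: "int \<Rightarrow> 'w \<Rightarrow> int \<times> int \<times> int"
    and n :: nat and k\<^sub>0 k\<^sub>1 k\<^sub>2 \<delta>\<^sub>1 m\<^sub>1 s\<^sub>1 \<delta>\<^sub>2 m\<^sub>2 s\<^sub>2 :: int
  assumes "n \<ge> 1"
    and "0 < k\<^sub>1 \<and> k\<^sub>1 < k\<^sub>2 \<or> k\<^sub>1 < k\<^sub>2 \<and> k\<^sub>2 < 0"
    and "m\<^sub>1 > 0" and "m\<^sub>2 > 0"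
    and "companion_process P k\<^sub>0 Z" and "k\<^sub>0 \<le> k\<^sub>1"
    and "\<P>(\<omega> in P. Z k\<^sub>1 \<omega> = (\<delta>\<^sub>1, m\<^sub>1, s\<^sub>1) \<and> Z k\<^sub>2 \<omega> = (\<delta>\<^sub>2, m\<^sub>2, s\<^sub>2)) > 0"
    and "\<P>(T in random_tree n. tree_Z T k\<^sub>1 = (\<delta>\<^sub>1, m\<^sub>1, s\<^sub>1) \<and> tree_Z T k\<^sub>2 = (\<delta>\<^sub>2, m\<^sub>2, s\<^sub>2)) > 0"
  shows "bridge_law P Z k\<^sub>1 k\<^sub>2 (\<delta>\<^sub>1, m\<^sub>1, s\<^sub>1) (\<delta>\<^sub>2, m\<^sub>2, s\<^sub>2) =
         bridge_law (random_tree n) (\<lambda>j T. tree_Z T j) k\<^sub>1 k\<^sub>2 (\<delta>\<^sub>1, m\<^sub>1, s\<^sub>1) (\<delta>\<^sub>2, m\<^sub>2, s\<^sub>2)"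
proof -
  note k = assms(2) and cp = assms(5) and posP = assms(7) and posT = assms(8)
  let ?z\<^sub>1 = "(\<delta>\<^sub>1, m\<^sub>1, s\<^sub>1)" and ?z\<^sub>2 = "(\<delta>\<^sub>2, m\<^sub>2, s\<^sub>2)"
  have k12: "k\<^sub>1 < k\<^sub>2" using k by auto
  from cp interpret prob_space P by (simp add: companion_process_def)
  have meas: "Z j \<in> P \<rightarrow>\<^sub>M count_space UNIV" if "k\<^sub>1 \<le> j" for j
    using cp that assms(6) by (simp add: companion_process_def)
  \<comment> \<open>the chain itself may start with \<open>m\<^sub>1 < \<delta>\<^sub>1\<close>; that some tree attains the state excludes this\<close>
  obtain T\<^sub>0 :: "unit tree" where "tree_Z T\<^sub>0 k\<^sub>1 = ?z\<^sub>1"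
    using posT by (metis (mono_tags, lifting) Collect_empty_eq less_irrefl measure_empty)
  then have \<delta>\<^sub>1: "\<delta>\<^sub>1 \<le> m\<^sub>1" by (auto simp: tree_Z_eq profile_Z_def)
  define p where "p = \<P>(\<omega> in P. Z k\<^sub>1 \<omega> = ?z\<^sub>1)"
  have "\<P>(\<omega> in P. Z k\<^sub>1 \<omega> = ?z\<^sub>1 \<and> Z k\<^sub>2 \<omega> = ?z\<^sub>2) \<le> p"
    unfolding p_def using meas[of k\<^sub>1]
    by (intro finite_measure_mono) auto
  then have p: "p > 0" using posP by linarith
  obtain C where C: "C \<ge> 0" and card: "\<And>z. z k\<^sub>1 = ?z\<^sub>1 \<Longrightarrow> z k\<^sub>2 = ?z\<^sub>2 \<Longrightarrow> admissible k\<^sub>1 k\<^sub>2 z \<Longrightarrow>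
    real (card {T :: unit tree. size T = n \<and> (\<forall>j\<in>{k\<^sub>1..k\<^sub>2}. tree_Z T j = z j)}) = C * path_weight k\<^sub>1 k\<^sub>2 z"
    using card_tree_paths[OF k, of ?z\<^sub>1 ?z\<^sub>2 n] by blast
  define N where "N = real (card {T :: unit tree. size T = n})"
  define e where "e = nat (2 * (s\<^sub>2 - s\<^sub>1) + (2 * m\<^sub>1 - \<delta>\<^sub>1) - (2 * m\<^sub>2 - \<delta>\<^sub>2))"
  have N: "N \<ge> 0" by (simp add: N_def)
  have tree: "\<P>(T in random_tree n. \<forall>j\<in>{k\<^sub>1..k\<^sub>2}. tree_Z T j = z j) =
    real (card {T :: unit tree. size T = n \<and> (\<forall>j\<in>{k\<^sub>1..k\<^sub>2}. tree_Z T j = z j)}) / N" for z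
  proof -
    have "finite {T :: unit tree. size T = n}"
      by (rule finite_subset[OF _ finite_trees[of n]]) auto
    then show ?thesis
      using ex_tree[of n] unfolding random_tree_def N_def
      by (simp add: measure_pmf_of_set Collect_conj_eq)
  qed
  have "bridge_law (random_tree n) (\<lambda>j T. tree_Z T j) k\<^sub>1 k\<^sub>2 ?z\<^sub>1 ?z\<^sub>2 = bridge_law P Z k\<^sub>1 k\<^sub>2 ?z\<^sub>1 ?z\<^sub>2"
  proof (rule bridge_law_eqI[where c = "C * 2 ^ e / (N * p)"])
    fix z :: "int \<Rightarrow> int \<times> int \<times> int"
    assume z: "z k\<^sub>1 = ?z\<^sub>1" "z k\<^sub>2 = ?z\<^sub>2"
    have chain: "\<P>(\<omega> in P. \<forall>j\<in>{k\<^sub>1..k\<^sub>2}. Z j \<omega> = z j) =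
      p * (\<Prod>j\<in>{k\<^sub>1..<k\<^sub>2}. pmf (companion_step (z j)) (z (j + 1)))"
      using companion_path[OF cp assms(6), of k\<^sub>2 z] k12 by (simp add: p_def z)
    show "\<P>(T in random_tree n. \<forall>j\<in>{k\<^sub>1..k\<^sub>2}. tree_Z T j = z j) =
      C * 2 ^ e / (N * p) * \<P>(\<omega> in P. \<forall>j\<in>{k\<^sub>1..k\<^sub>2}. Z j \<omega> = z j)"
    proof (cases "admissible k\<^sub>1 k\<^sub>2 z")
      case True
      have "(\<Prod>j\<in>{k\<^sub>1..<k\<^sub>2}. pmf (companion_step (z j)) (z (j + 1))) = path_weight k\<^sub>1 k\<^sub>2 z / 2 ^ e"
        using companion_path_weight[OF True] k12 \<delta>\<^sub>1 by (simp add: z e_def)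
      then show ?thesis
        unfolding tree chain card[OF z True] using p by simp
    next
      case False
      have "\<not> (\<forall>j\<in>{k\<^sub>1..k\<^sub>2}. tree_Z T j = z j)" for T :: "unit tree"
      proof
        assume "\<forall>j\<in>{k\<^sub>1..k\<^sub>2}. tree_Z T j = z j"
        then have "admissible k\<^sub>1 k\<^sub>2 z"
          using assms(3,4) z by (intro tree_path_admissible[OF k, of T z]) auto
        with False show False by simp
      qed
      then have "{T :: unit tree. size T = n \<and> (\<forall>j\<in>{k\<^sub>1..k\<^sub>2}. tree_Z T j = z j)} = {}"
        by blast
      moreover have "(\<Prod>j\<in>{k\<^sub>1..<k\<^sub>2}. pmf (companion_step (z j)) (z (j + 1))) = 0"
        using companion_path_admissible[where z = z and k\<^sub>1 = k\<^sub>1 and k\<^sub>2 = k\<^sub>2] False assms(4) z by auto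
      ultimately show ?thesis unfolding tree chain by (simp only: card.empty of_nat_0 div_0 mult_zero_right)
    qed
  next
    show "C * 2 ^ e / (N * p) \<ge> 0" using C N p by simp
  qed (use k12 meas posP posT in \<open>simp_all add: measure_pmf.prob_space_axioms prob_space_axioms\<close>)
  then show ?thesis by simp
qed

end
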